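(* Let $k$ be a field, $L_n=k[z_1^{\pm1},\dots,z_n^{\pm1}]$ the Laurent polynomial algebra, $\sigma$ a $k$-algebra automorphism of $L_n$, $a\in L_n$, and $A=L_n(\sigma,a)$ the generalized Weyl algebra. Write $\sigma(z_i)=\alpha_iz_1^{a_{1i}}z_2^{a_{2i}}\cdots z_n^{a_{ni}}$ with $\alpha_i\in k^*$, $a_{ji}\in\mathbb{Z}$, and let $M_\sigma=(a_{ij})\in\mathbb{Z}^{n\times n}$. Then the following are equivalent: (a) $\operatorname{GKdim}(A)=n+1$; (b) $\sigma$ is locally algebraic; (c) $M_\sigma$ has finite order, i.e. $M_\sigma^m$ is the identity matrix for some $m\geq 1$; (d) $M_\sigma$ is power-bounded, i.e. there is $N>0$ such that the absolute values of all entries of $M_\sigma^m$ are less than $N$ for all $m\geq1$.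
   Context: Every automorphism of $L_n$ maps each $z_i$ to a unit, hence has the displayed form. For an algebra $D$, an automorphism $\sigma$ and a central $a\in D$, the generalized Weyl algebra $D(\sigma,a)$ is generated by $D$ and indeterminates $x,y$ subject to $xd=\sigma(d)x$, $yd=\sigma^{-1}(d)y$ ($d\in D$), $yx=a$, $xy=\sigma(a)$. $\operatorname{GKdim}(B)=\sup_V\limsup_{n\to\infty}\log_n\dim_k(\sum_{i=0}^nV^i)$ over finite-dimensional subspaces $V$. An automorphism $\sigma$ of $D$ is locally algebraic if every finite-dimensional subspace of $D$ lies in a finite-dimensional subspace $U$ with $\sigma(U)=U$. *)

theory Defs
  imports "HOL-Analysis.Analysis" "HOL-Library.Poly_Mapping" "HOL-Library.Function_Algebras"
begin

text \<open>The variables are indexed by a finite type 'n (so n = CARD('n)).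
  L_n is the group algebra of Z^n: finitely supported functions from exponent
  vectors ('n => int) to k, with convolution product (Poly_Mapping).\<close>

type_synonym ('n, 'k) laurent = "('n \<Rightarrow> int) \<Rightarrow>\<^sub>0 'k"

definition lvar :: "'n \<Rightarrow> ('n, 'k::comm_ring_1) laurent" where
  "lvar i = Poly_Mapping.single (\<lambda>j. if j = i then 1 else 0) 1"

definition lscale :: "'k::comm_ring_1 \<Rightarrow> ('n, 'k) laurent \<Rightarrow> ('n, 'k) laurent" where
  "lscale c p = Poly_Mapping.map (\<lambda>d. c * d) p"

definition k_alg_automorphism :: "(('n, 'k::field) laurent \<Rightarrow> ('n, 'k) laurent) \<Rightarrow> bool" where
  "k_alg_automorphism \<sigma> \<longleftrightarrow> bij \<sigma>
     \<and> (\<forall>p q. \<sigma> (p + q) = \<sigma> p + \<sigma> q)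
     \<and> (\<forall>p q. \<sigma> (p * q) = \<sigma> p * \<sigma> q)
     \<and> \<sigma> 1 = 1
     \<and> (\<forall>c p. \<sigma> (lscale c p) = lscale c (\<sigma> p))"

text \<open>The matrix M_sigma = (a_ij): sigma(z_j) = alpha_j * prod_i z_i^(a_ij), i.e.
  column j of M_sigma is the exponent vector of the monomial sigma(z_j).\<close>
definition sigma_matrix :: "(('n::finite, 'k::field) laurent \<Rightarrow> ('n, 'k) laurent) \<Rightarrow> int ^'n ^'n" where
  "sigma_matrix \<sigma> = (\<chi> i j. (SOME v. \<exists>\<alpha>. \<alpha> \<noteq> 0 \<and> \<sigma> (lvar j) = Poly_Mapping.single v \<alpha>) i)"

fun mat_pow :: "int ^'n ^'n \<Rightarrow> nat \<Rightarrow> int ^'n ^'n" where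
  "mat_pow M 0 = mat 1"
| "mat_pow M (Suc m) = M ** mat_pow M m"

definition locally_algebraic :: "(('n, 'k::field) laurent \<Rightarrow> ('n, 'k) laurent) \<Rightarrow> bool" where
  "locally_algebraic \<sigma> \<longleftrightarrow>
     (\<forall>W. (\<exists>S. finite S \<and> W = module.span lscale S) \<longrightarrow>
        (\<exists>U. (\<exists>T. finite T \<and> U = module.span lscale T) \<and> W \<subseteq> U \<and> \<sigma> ` U = U))"

definition ipow :: "('d \<Rightarrow> 'd) \<Rightarrow> int \<Rightarrow> 'd \<Rightarrow> 'd" where
  "ipow \<sigma> i = (if i \<ge> 0 then \<sigma> ^^ nat i else (inv \<sigma>) ^^ nat (- i))"

text \<open>Model: D(sigma,a) is the free left D-module with basis v_m (m in Z), where
  v_m = x^m for m >= 0 and v_m = y^(-m) for m < 0. An element is the finitely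
  supported map m |-> d_m, representing sum_m d_m v_m. The multiplication is
  determined by v_m d = sigma^m(d) v_m and v_m v_l = gwa_coeff m l * v_(m+l),
  where (for D commutative)
    x^m y^p = prod_{i=m-t+1}^{m} sigma^i(a) v_(m-p),   t = min m p,
    y^p x^l = prod_{i=p-t}^{p-1} sigma^(-i)(a) v_(l-p), t = min p l,
  and v_m v_l = v_(m+l) when m, l have the same sign.\<close>
definition gwa_coeff :: "('d::comm_ring_1 \<Rightarrow> 'd) \<Rightarrow> 'd \<Rightarrow> int \<Rightarrow> int \<Rightarrow> 'd" where
  "gwa_coeff \<sigma> a m l =
     (if m > 0 \<and> l < 0 then
        (let t = min m (- l) in \<Prod>i\<in>{m - t + 1..m}. ipow \<sigma> i a)
      else if m < 0 \<and> l > 0 then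
        (let p = - m; t = min p l in \<Prod>i\<in>{p - t..p - 1}. ipow \<sigma> (- i) a)
      else 1)"

type_synonym 'd gwa = "int \<Rightarrow>\<^sub>0 'd"

definition gwa_mult :: "('d::comm_ring_1 \<Rightarrow> 'd) \<Rightarrow> 'd \<Rightarrow> 'd gwa \<Rightarrow> 'd gwa \<Rightarrow> 'd gwa" where
  "gwa_mult \<sigma> a f g =
     (\<Sum>m\<in>Poly_Mapping.keys f. \<Sum>l\<in>Poly_Mapping.keys g.
        Poly_Mapping.single (m + l)
          (Poly_Mapping.lookup f m * ipow \<sigma> m (Poly_Mapping.lookup g l) * gwa_coeff \<sigma> a m l))"

definition gwa_one :: "'d::comm_ring_1 gwa" where
  "gwa_one = Poly_Mapping.single 0 1"

definition gwa_scale :: "'k::comm_ring_1 \<Rightarrow> ('n, 'k) laurent gwa \<Rightarrow> ('n, 'k) laurent gwa" where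
  "gwa_scale c f = Poly_Mapping.map (lscale c) f"

definition gwa_prod_list ::
  "(('n, 'k::field) laurent \<Rightarrow> ('n, 'k) laurent) \<Rightarrow> ('n, 'k) laurent
     \<Rightarrow> ('n, 'k) laurent gwa list \<Rightarrow> ('n, 'k) laurent gwa" where
  "gwa_prod_list \<sigma> a xs = foldr (gwa_mult \<sigma> a) xs gwa_one"

definition gwa_power_space ::
  "(('n, 'k::field) laurent \<Rightarrow> ('n, 'k) laurent) \<Rightarrow> ('n, 'k) laurent
     \<Rightarrow> ('n, 'k) laurent gwa set \<Rightarrow> nat \<Rightarrow> ('n, 'k) laurent gwa set" where
  "gwa_power_space \<sigma> a V i =
     module.span gwa_scale {gwa_prod_list \<sigma> a xs | xs. set xs \<subseteq> V \<and> length xs = i}"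

text \<open>dim_k (sum_{i=0}^N V^i).\<close>
definition gwa_growth ::
  "(('n, 'k::field) laurent \<Rightarrow> ('n, 'k) laurent) \<Rightarrow> ('n, 'k) laurent
     \<Rightarrow> ('n, 'k) laurent gwa set \<Rightarrow> nat \<Rightarrow> nat" where
  "gwa_growth \<sigma> a V N = vector_space.dim gwa_scale (\<Union>i\<in>{0..N}. gwa_power_space \<sigma> a V i)"

definition GKdim_gwa ::
  "(('n, 'k::field) laurent \<Rightarrow> ('n, 'k) laurent) \<Rightarrow> ('n, 'k) laurent \<Rightarrow> ereal" where
  "GKdim_gwa \<sigma> a =
     (SUP V \<in> {V. \<exists>S. finite S \<and> V = module.span gwa_scale S}.
        limsup (\<lambda>N. ereal (ln (real (gwa_growth \<sigma> a V N)) / ln (real N))))"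

end

theory Submission
  imports Defs "HOL-Real_Asymp.Real_Asymp"
begin

text \<open>Units of the Laurent algebra are monomials, so \<open>\<sigma>\<close> acts on exponents through the matrix
  \<open>M = M\<^sub>\<sigma>\<close>, and (b), (c), (d) all say that the orbits of \<open>M\<close> on exponent vectors are bounded;
  a bounded set of integer matrices is finite, so bounded powers force finite order.

  If \<open>M\<close> has finite order, balls for an \<open>M\<close>-invariant norm on exponents show that \<open>V\<^sup>N\<close> is supported
  on \<open>O(N)\<close> powers of \<open>x\<close> and \<open>y\<close> with exponents in a ball of radius \<open>O(N)\<close>, whatever \<open>a\<close> is.

  If \<open>M\<close> has infinite order, pigeonhole gives, for every \<open>q\<close>, a power \<open>M\<^sup>i\<close> with an entry larger than
  \<open>q\<close> and \<open>i \<le> K = (2q+1)^(n\<^sup>2)\<close>. The words \<open>z\<^sup>u x\<^sup>i z\<^sub>j\<^sup>t x\<^bsup>r-i\<^esup>\<close> of length \<open>O(K)\<close> then produce at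
  least \<open>K\<^bsup>n+1\<^esup> q\<close> distinct monomials, so the dimension is at least \<open>n + 1 + 1/n\<^sup>2\<close>. This crude
  bound replaces the growth estimates that the Jordan form of \<open>M\<close> would give.\<close>

section \<open>Laurent monomials and units\<close>

lemma poly_mapping_eq_sum_single:
  "p = (\<Sum>v\<in>Poly_Mapping.keys p. Poly_Mapping.single v (Poly_Mapping.lookup p v))"
proof (rule poly_mapping_eqI)
  fix k
  have "Poly_Mapping.lookup (\<Sum>v\<in>Poly_Mapping.keys p. Poly_Mapping.single v (Poly_Mapping.lookup p v)) k
      = (\<Sum>v\<in>Poly_Mapping.keys p. if v = k then Poly_Mapping.lookup p v else 0)"
    by (simp add: lookup_sum lookup_single when_def)
  also have "\<dots> = Poly_Mapping.lookup p k"
    by (simp add: in_keys_iff)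
  finally show "Poly_Mapping.lookup p k
      = Poly_Mapping.lookup (\<Sum>v\<in>Poly_Mapping.keys p. Poly_Mapping.single v (Poly_Mapping.lookup p v)) k" ..
qed

section \<open>Coefficients and the two vector space structures\<close>

lemma lookup_lscale [simp]: "Poly_Mapping.lookup (lscale c p) v = c * Poly_Mapping.lookup p v"
  by (simp add: lscale_def Poly_Mapping.map.rep_eq when_def)

lemma lscale_single [simp]: "lscale c (Poly_Mapping.single v d) = Poly_Mapping.single v (c * d)"
  by (rule poly_mapping_eqI) (simp add: lookup_single when_def)

lemma lookup_gwa_scale [simp]:
  "Poly_Mapping.lookup (gwa_scale c F) m = lscale c (Poly_Mapping.lookup F m)"
  by (rule poly_mapping_eqI) (simp add: gwa_scale_def Poly_Mapping.map.rep_eq when_def)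

interpretation lau: vector_space "lscale :: 'k::field \<Rightarrow> ('n, 'k) laurent \<Rightarrow> ('n, 'k) laurent"
  by unfold_locales (rule poly_mapping_eqI, simp add: lookup_add algebra_simps)+

interpretation gwa: vector_space
  "gwa_scale :: 'k::field \<Rightarrow> ('n, 'k) laurent gwa \<Rightarrow> ('n, 'k) laurent gwa"
  by unfold_locales ((rule poly_mapping_eqI)+, simp add: lookup_add algebra_simps)+

text \<open>The weights are chosen one coordinate at a time, each larger than every partial sum
  that occurred so far.\<close>

lemma ex_weights_nonzero:
  fixes D :: "('n \<Rightarrow> int) set"
  assumes "finite D" and "finite A"
  shows "\<exists>c. \<forall>d\<in>D. (\<exists>i\<in>A. d i \<noteq> 0) \<longrightarrow> (\<Sum>i\<in>A. c i * d i) \<noteq> (0::int)"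
  using assms(2)
proof induction
  case empty
  then show ?case by simp
next
  case (insert b A)
  then obtain c where c: "\<forall>d\<in>D. (\<exists>i\<in>A. d i \<noteq> 0) \<longrightarrow> (\<Sum>i\<in>A. c i * d i) \<noteq> (0::int)"
    by blast
  define B where "B = 1 + (\<Sum>d\<in>D. \<bar>\<Sum>i\<in>A. c i * d i\<bar>)"
  have B: "\<bar>\<Sum>i\<in>A. c i * d i\<bar> < B" if "d \<in> D" for d
    using member_le_sum[of d D "\<lambda>d. \<bar>\<Sum>i\<in>A. c i * d i\<bar>"] that assms(1)
    by (simp add: B_def)
  show ?case
  proof (intro exI[of _ "c(b := B)"] ballI impI)
    fix d assume d: "d \<in> D" and ex: "\<exists>i\<in>insert b A. d i \<noteq> 0"
    have *: "(\<Sum>i\<in>insert b A. (c(b := B)) i * d i) = B * d b + (\<Sum>i\<in>A. c i * d i)"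
      using insert.hyps by (auto intro!: sum.cong)
    show "(\<Sum>i\<in>insert b A. (c(b := B)) i * d i) \<noteq> 0"
    proof (cases "d b = 0")
      case True
      then show ?thesis using * c d ex by auto
    next
      case False
      have "B * 1 \<le> B * \<bar>d b\<bar>"
        using False B[OF d] by (intro mult_left_mono) auto
      then have "\<bar>\<Sum>i\<in>A. c i * d i\<bar> < \<bar>B * d b\<bar>"
        using B[OF d] by (simp add: abs_mult)
      then show ?thesis using * by linarith
    qed
  qed
qed

text \<open>Apply the preceding lemma to the finite set of differences: a weight form that vanishes
  on no nonzero difference separates the points.\<close>

lemma ex_weights_inj_on:
  fixes X :: "('n::finite \<Rightarrow> int) set"
  assumes "finite X"
  shows "\<exists>c. inj_on (\<lambda>v. \<Sum>i\<in>UNIV. c i * v i) X"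
proof -
  obtain c :: "'n \<Rightarrow> int" where c: "\<forall>d\<in>(\<lambda>(u, w). u - w) ` (X \<times> X).
      (\<exists>i\<in>UNIV. d i \<noteq> 0) \<longrightarrow> (\<Sum>i\<in>UNIV. c i * d i) \<noteq> (0::int)"
    using ex_weights_nonzero[of "(\<lambda>(u, w). u - w) ` (X \<times> X)" UNIV] assms by auto
  show ?thesis
  proof (intro exI[of _ c] inj_onI, rule ccontr)
    fix u w assume uw: "u \<in> X" "w \<in> X" "(\<Sum>i\<in>UNIV. c i * u i) = (\<Sum>i\<in>UNIV. c i * w i)" "u \<noteq> w"
    then have "\<exists>i\<in>UNIV. (u - w) i \<noteq> 0" by (auto simp: fun_eq_iff)
    moreover have "(\<Sum>i\<in>UNIV. c i * (u - w) i) = 0"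
      using uw by (simp add: algebra_simps sum_subtractf)
    ultimately show False using c uw by blast
  qed
qed

text \<open>Additivity of \<open>L\<close> leaves \<open>(u, w)\<close> as the only pair of
  exponents with sum \<open>u + w\<close>, since any other pair has smaller total weight. Nothing
  cancels, and the coefficient is a product of two nonzero field elements.\<close>

lemma lookup_mult_extremal:
  fixes p q :: "('n, 'k::field) laurent" and L :: "('n \<Rightarrow> int) \<Rightarrow> int"
  assumes add: "\<And>u w. L (u + w) = L u + L w"
    and u: "u \<in> Poly_Mapping.keys p" "\<And>u'. u' \<in> Poly_Mapping.keys p \<Longrightarrow> u' \<noteq> u \<Longrightarrow> L u' < L u"
    and w: "w \<in> Poly_Mapping.keys q" "\<And>w'. w' \<in> Poly_Mapping.keys q \<Longrightarrow> w' \<noteq> w \<Longrightarrow> L w' < L w"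
  shows "Poly_Mapping.lookup (p * q) (u + w) \<noteq> 0"
proof -
  have "p * q = (\<Sum>u\<in>Poly_Mapping.keys p. \<Sum>w\<in>Poly_Mapping.keys q.
      Poly_Mapping.single (u + w) (Poly_Mapping.lookup p u * Poly_Mapping.lookup q w))"
    by (subst (1) poly_mapping_eq_sum_single[of p], subst (1) poly_mapping_eq_sum_single[of q])
      (simp add: sum_product mult_single)
  then have "Poly_Mapping.lookup (p * q) (u + w) = (\<Sum>u'\<in>Poly_Mapping.keys p. \<Sum>w'\<in>Poly_Mapping.keys q.
      (Poly_Mapping.lookup p u' * Poly_Mapping.lookup q w' when u' + w' = u + w))"
    by (simp add: lookup_sum lookup_single)
  also have "\<dots> = (\<Sum>u'\<in>Poly_Mapping.keys p. \<Sum>w'\<in>Poly_Mapping.keys q.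
      if w' = w then (if u' = u then Poly_Mapping.lookup p u * Poly_Mapping.lookup q w else 0) else 0)"
  proof (intro sum.cong refl)
    fix u' w' assume k: "u' \<in> Poly_Mapping.keys p" "w' \<in> Poly_Mapping.keys q"
    have "u' = u \<and> w' = w" if "u' + w' = u + w"
    proof (rule ccontr)
      assume "\<not> ?thesis"
      then have "L u' + L w' < L u + L w"
        using u(2)[OF k(1)] w(2)[OF k(2)] by (cases "u' = u"; cases "w' = w") auto
      then show False using that add by (metis less_irrefl)
    qed
    then show "(Poly_Mapping.lookup p u' * Poly_Mapping.lookup q w' when u' + w' = u + w)
      = (if w' = w then (if u' = u then Poly_Mapping.lookup p u * Poly_Mapping.lookup q w else 0) else 0)"
      by (auto simp: when_def)
  qed
  also have "\<dots> = Poly_Mapping.lookup p u * Poly_Mapping.lookup q w"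
    using u(1) w(1) by simp
  finally show ?thesis using u(1) w(1) by (simp add: in_keys_iff)
qed

lemma ex_strict_max:
  fixes L :: "'a \<Rightarrow> int"
  assumes "finite X" "X \<noteq> {}" "inj_on L X"
  obtains u where "u \<in> X" "\<And>u'. u' \<in> X \<Longrightarrow> u' \<noteq> u \<Longrightarrow> L u' < L u"
proof -
  have "Max (L ` X) \<in> L ` X" using assms by simp
  then obtain u where u: "u \<in> X" "L u = Max (L ` X)" by auto
  have "L u' < L u" if "u' \<in> X" "u' \<noteq> u" for u'
    using Max_ge[of "L ` X" "L u'"] that u assms inj_onD[OF assms(3), of u' u]
    by (auto simp: order_less_le)
  then show ?thesis using u that by blast
qed

text \<open>For a weight that separates the exponents, the product of the leading terms and the product
  of the trailing terms both survive; if the product of \<open>p\<close> and \<open>q\<close> is \<open>1\<close>, they coincide.\<close>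

lemma laurent_unit_is_monomial:
  fixes p q :: "('n::finite, 'k::field) laurent"
  assumes "p * q = 1"
  obtains v \<alpha> where "\<alpha> \<noteq> 0" "p = Poly_Mapping.single v \<alpha>"
proof -
  have ne: "Poly_Mapping.keys p \<noteq> {}" "Poly_Mapping.keys q \<noteq> {}"
    using assms by auto
  obtain c :: "'n \<Rightarrow> int" where c: "inj_on (\<lambda>v. \<Sum>i\<in>UNIV. c i * v i) (Poly_Mapping.keys p \<union> Poly_Mapping.keys q)"
    using ex_weights_inj_on[OF finite_UnI[OF finite_keys[of p] finite_keys[of q]]] by blast
  define L where "L = (\<lambda>v. \<Sum>i\<in>UNIV. c i * v i)"
  have add: "L (u + w) = L u + L w" for u w
    by (simp add: L_def algebra_simps sum.distrib)
  have inj: "inj_on L (Poly_Mapping.keys p)" "inj_on L (Poly_Mapping.keys q)"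
    using c unfolding L_def[symmetric] by (auto intro: inj_on_subset)
  \<comment> \<open>The trailing terms are the leading terms for the negated weight, so one
    extremality lemma serves both ends.\<close>
  have inj': "inj_on (\<lambda>v. - L v) (Poly_Mapping.keys p)" "inj_on (\<lambda>v. - L v) (Poly_Mapping.keys q)"
    using inj by (auto simp: inj_on_def)
  have L0: "L 0 = 0" by (simp add: L_def)
  have zero: "x = 0" if "Poly_Mapping.lookup (p * q) x \<noteq> 0" for x
    using that assms by (auto simp: lookup_one when_def split: if_splits)
  obtain u where u: "u \<in> Poly_Mapping.keys p" "\<And>u'. u' \<in> Poly_Mapping.keys p \<Longrightarrow> u' \<noteq> u \<Longrightarrow> L u' < L u"
    by (rule ex_strict_max[OF finite_keys ne(1) inj(1)]) blast
  obtain w where w: "w \<in> Poly_Mapping.keys q" "\<And>w'. w' \<in> Poly_Mapping.keys q \<Longrightarrow> w' \<noteq> w \<Longrightarrow> L w' < L w"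
    by (rule ex_strict_max[OF finite_keys ne(2) inj(2)]) blast
  obtain u1 where u1: "u1 \<in> Poly_Mapping.keys p"
      "\<And>u'. u' \<in> Poly_Mapping.keys p \<Longrightarrow> u' \<noteq> u1 \<Longrightarrow> - L u' < - L u1"
    by (rule ex_strict_max[OF finite_keys ne(1) inj'(1)]) blast
  obtain w1 where w1: "w1 \<in> Poly_Mapping.keys q"
      "\<And>w'. w' \<in> Poly_Mapping.keys q \<Longrightarrow> w' \<noteq> w1 \<Longrightarrow> - L w' < - L w1"
    by (rule ex_strict_max[OF finite_keys ne(2) inj'(2)]) blast
  have "u + w = 0"
    by (rule zero, rule lookup_mult_extremal[OF add u w])
  moreover have "u1 + w1 = 0"
    by (rule zero, rule lookup_mult_extremal[OF _ u1 w1]) (simp only: add minus_add_distrib)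
  ultimately have "L u + L w = 0" "L u1 + L w1 = 0" using L0 by (simp_all flip: add)
  \<comment> \<open>Both extremal products sit at exponent 0. As \<open>w1\<close> weighs no more
    than \<open>w\<close>, the lightest exponent \<open>u1\<close> of \<open>p\<close> weighs at
    least as much as the heaviest one \<open>u\<close>, so \<open>p\<close> has a single
    exponent.\<close>
  moreover have "L w1 \<le> L w" using w(2)[OF w1(1)] by fastforce
  ultimately have "L u \<le> L u1" by linarith
  then have "u1 = u" using u(2)[OF u1(1)] by fastforce
  then have "u' = u" if "u' \<in> Poly_Mapping.keys p" for u'
    using u(2)[OF that] u1(2)[OF that] \<open>u1 = u\<close> by fastforce
  then have "Poly_Mapping.keys p = {u}" using u(1) by blast
  then have "(\<Sum>v\<in>Poly_Mapping.keys p. Poly_Mapping.single v (Poly_Mapping.lookup p v))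
      = Poly_Mapping.single u (Poly_Mapping.lookup p u)" by simp
  then have "p = Poly_Mapping.single u (Poly_Mapping.lookup p u)"
    by (rule trans[OF poly_mapping_eq_sum_single])
  moreover have "Poly_Mapping.lookup p u \<noteq> 0" using u(1) by (simp add: in_keys_iff)
  ultimately show ?thesis using that by blast
qed

section \<open>The action of an automorphism on exponents\<close>

lemma single_inject_exponent:
  assumes "Poly_Mapping.single v c = Poly_Mapping.single w d" "c \<noteq> 0"
  shows "v = w"
proof -
  have "Poly_Mapping.lookup (Poly_Mapping.single w d) v \<noteq> 0"
    using assms by (metis lookup_single_eq)
  then show ?thesis by (auto simp: lookup_single when_def split: if_splits)
qed

definition unit_vec :: "'n \<Rightarrow> 'n \<Rightarrow> int" where
  "unit_vec j = (\<lambda>i. if i = j then 1 else 0)"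

lemma lvar_eq_single: "lvar j = Poly_Mapping.single (unit_vec j) 1"
  by (simp add: lvar_def unit_vec_def)

lemma lvar_power: "lvar j ^ t = Poly_Mapping.single (\<lambda>i. int t * unit_vec j i) 1"
  by (induction t) (auto simp: lvar_eq_single mult_single algebra_simps zero_fun_def fun_eq_iff
      intro!: arg_cong2[where f = Poly_Mapping.single] simp flip: single_one)

lemma additive_nat_times:
  fixes h :: "('n \<Rightarrow> int) \<Rightarrow> 'n \<Rightarrow> int"
  assumes h: "\<And>u w. h (u + w) = h u + h w"
  shows "h (\<lambda>i. int t * u i) = (\<lambda>i. int t * h u i)"
proof (induction t)
  case 0
  have "h 0 = 0" using h[of 0 0] by simp
  then show ?case by (simp add: zero_fun_def)
next
  case (Suc t)
  have "(\<lambda>i. int (Suc t) * u i) = (\<lambda>i. int t * u i) + u"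
    by (auto simp: fun_eq_iff algebra_simps)
  then have "h (\<lambda>i. int (Suc t) * u i) = (\<lambda>i. int t * h u i) + h u"
    using Suc by (simp only: h)
  then show ?case by (auto simp: algebra_simps fun_eq_iff)
qed

text \<open>An additive map on Z^n is Z-linear, hence determined by its values at the unit vectors.
  This is what turns iteration of exponent maps into matrix multiplication.\<close>

lemma additive_int_combination:
  fixes h :: "('n::finite \<Rightarrow> int) \<Rightarrow> 'n \<Rightarrow> int"
  assumes h: "\<And>u w. h (u + w) = h u + h w"
  shows "h v i = (\<Sum>j\<in>UNIV. h (unit_vec j) i * v j)"
proof -
  have h0: "h 0 = 0" using h[of 0 0] by simp
  have hm: "h (- u) = - h u" for u
    using h[of u "- u"] h0 by (simp only: add.right_inverse eq_neg_iff_add_eq_0 add.commute)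
  have hz: "h (\<lambda>i. z * u i) = (\<lambda>i. z * h u i)" for z u
  proof (cases "z \<ge> 0")
    case True
    then show ?thesis using additive_nat_times[OF h, of "nat z" u] by simp
  next
    case False
    have "(\<lambda>i. z * u i) = - (\<lambda>i. int (nat (- z)) * u i)"
      using False by (auto simp: fun_eq_iff)
    then have "h (\<lambda>i. z * u i) = - (\<lambda>i. int (nat (- z)) * h u i)"
      by (simp only: hm additive_nat_times[OF h])
    then show ?thesis using False by (auto simp: fun_eq_iff)
  qed
  have hs: "h (\<Sum>j\<in>A. g j) = (\<Sum>j\<in>A. h (g j))" if "finite A" for A and g :: "'n \<Rightarrow> 'n \<Rightarrow> int"
    using that by induction (simp_all only: sum.empty sum.insert h h0 not_False_eq_True)
  have sum_app: "(\<Sum>j\<in>A. g j) x = (\<Sum>j\<in>A. g j x)" if "finite A" for A and g :: "'n \<Rightarrow> 'n \<Rightarrow> int" and x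
    using that by induction auto
  have "v = (\<Sum>j\<in>UNIV. (\<lambda>i. v j * unit_vec j i))"
    by (auto simp: fun_eq_iff sum_app unit_vec_def if_distrib cong: if_cong)
  then have "h v = (\<Sum>j\<in>UNIV. h (\<lambda>i. v j * unit_vec j i))"
    using hs[of UNIV "\<lambda>j i. v j * unit_vec j i"] by simp
  then show ?thesis by (simp add: sum_app hz mult.commute)
qed

locale laurent_aut =
  fixes \<sigma> :: "('n::finite, 'k::field) laurent \<Rightarrow> ('n, 'k) laurent"
  assumes aut: "k_alg_automorphism \<sigma>"
begin

lemma bij: "bij \<sigma>" and add: "\<sigma> (p + q) = \<sigma> p + \<sigma> q" and mult: "\<sigma> (p * q) = \<sigma> p * \<sigma> q"
  and one: "\<sigma> 1 = 1" and scale: "\<sigma> (lscale c p) = lscale c (\<sigma> p)"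
  using aut by (auto simp: k_alg_automorphism_def)

lemma zero: "\<sigma> 0 = 0"
  using add[of 0 0] by simp

lemma sum: "\<sigma> (sum g A) = (\<Sum>x\<in>A. \<sigma> (g x))"
  by (induction A rule: infinite_finite_induct) (auto simp: zero add)

lemma inv_simps [simp]: "\<sigma> (inv \<sigma> p) = p" "inv \<sigma> (\<sigma> p) = p"
  using bij by (auto simp: bij_is_surj surj_f_inv_f bij_is_inj inv_f_f)

text \<open>The choice has the same form as the one in \<open>sigma_matrix\<close>, extended from
  the variables to all monomials, so that on unit vectors both agree by unfolding alone.\<close>

definition expo :: "('n \<Rightarrow> int) \<Rightarrow> 'n \<Rightarrow> int" where
  "expo v = (SOME w. \<exists>\<alpha>. \<alpha> \<noteq> 0 \<and> \<sigma> (Poly_Mapping.single v 1) = Poly_Mapping.single w \<alpha>)"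

definition coef :: "('n \<Rightarrow> int) \<Rightarrow> 'k" where
  "coef v = Poly_Mapping.lookup (\<sigma> (Poly_Mapping.single v 1)) (expo v)"

text \<open>A monomial is a unit with inverse of exponent \<open>- v\<close>; its image is again a
  unit and therefore a monomial.\<close>

lemma coef_nonzero: "coef v \<noteq> 0"
  and image_single_1: "\<sigma> (Poly_Mapping.single v 1) = Poly_Mapping.single (expo v) (coef v)"
proof -
  have "Poly_Mapping.single v 1 * Poly_Mapping.single (- v) 1 = (1 :: ('n, 'k) laurent)"
    by (simp add: mult_single)
  then have "\<sigma> (Poly_Mapping.single v 1) * \<sigma> (Poly_Mapping.single (- v) 1) = 1"
    using mult one by metis
  then have "\<exists>w \<alpha>. \<alpha> \<noteq> 0 \<and> \<sigma> (Poly_Mapping.single v 1) = Poly_Mapping.single w \<alpha>"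
    using laurent_unit_is_monomial by metis
  then have "\<exists>\<alpha>. \<alpha> \<noteq> 0 \<and> \<sigma> (Poly_Mapping.single v 1) = Poly_Mapping.single (expo v) \<alpha>"
    unfolding expo_def by (rule someI_ex)
  then show "coef v \<noteq> 0" "\<sigma> (Poly_Mapping.single v 1) = Poly_Mapping.single (expo v) (coef v)"
    by (auto simp: coef_def)
qed

lemma image_single: "\<sigma> (Poly_Mapping.single v c) = Poly_Mapping.single (expo v) (c * coef v)"
  using scale[of c "Poly_Mapping.single v 1"] by (simp add: image_single_1)

lemma expo_add: "expo (u + w) = expo u + expo w"
proof -
  have "\<sigma> (Poly_Mapping.single (u + w) 1) = \<sigma> (Poly_Mapping.single u 1) * \<sigma> (Poly_Mapping.single w 1)"
    by (simp add: mult_single flip: mult)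
  then have "Poly_Mapping.single (expo (u + w)) (coef (u + w))
      = Poly_Mapping.single (expo u + expo w) (coef u * coef w)"
    by (simp only: image_single_1 mult_single)
  then show ?thesis
    by (rule single_inject_exponent) (rule coef_nonzero)
qed

lemma expo_zero: "expo 0 = 0"
  using expo_add[of 0 0] by simp

lemma expo_inj: "inj expo"
proof (rule injI)
  fix u w assume "expo u = expo w"
  \<comment> \<open>The coefficients are crossed so that both images carry the same scalar
    \<open>coef u * coef w\<close>; injectivity of \<open>\<sigma>\<close> then applies.\<close>
  then have "\<sigma> (Poly_Mapping.single u (coef w)) = \<sigma> (Poly_Mapping.single w (coef u))"
    by (simp add: image_single mult.commute)
  then show "u = w"
    by (metis bij_is_inj[OF bij] injD single_inject_exponent coef_nonzero)
qed

lemma expo_bij: "bij expo"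
proof -
  have "\<exists>v. expo v = w" for w
  proof -
    \<comment> \<open>For surjectivity, the preimage of a monomial is a unit as well, hence a
      monomial, and its exponent is the required preimage of \<open>w\<close>.\<close>
    have "\<sigma> (inv \<sigma> (Poly_Mapping.single w 1) * inv \<sigma> (Poly_Mapping.single (- w) 1)) = \<sigma> 1"
      by (simp add: mult one mult_single)
    then have "inv \<sigma> (Poly_Mapping.single w 1) * inv \<sigma> (Poly_Mapping.single (- w) 1) = 1"
      by (metis inv_simps(2))
    then obtain v \<alpha> where "\<alpha> \<noteq> 0" "inv \<sigma> (Poly_Mapping.single w 1) = Poly_Mapping.single v \<alpha>"
      by (rule laurent_unit_is_monomial)
    then have "Poly_Mapping.single w 1 = Poly_Mapping.single (expo v) (\<alpha> * coef v)"
      by (metis inv_simps(1) image_single)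
    then have "w = expo v" by (rule single_inject_exponent) simp
    then show ?thesis by blast
  qed
  then show ?thesis using expo_inj by (auto simp: bij_def surj_def) metis
qed

lemma expo_inv_simps [simp]: "expo (inv expo v) = v" "inv expo (expo v) = v"
  using expo_bij by (auto simp: bij_is_surj surj_f_inv_f bij_is_inj inv_f_f)

text \<open>Distinct monomials have distinct image exponents, so no terms merge:
  \<open>\<sigma>\<close> permutes supports by \<open>expo\<close> and rescales coefficients by
  nonzero scalars.\<close>

lemma lookup_image: "Poly_Mapping.lookup (\<sigma> p) (expo v) = Poly_Mapping.lookup p v * coef v"
proof -
  have "\<sigma> p = (\<Sum>u\<in>Poly_Mapping.keys p. Poly_Mapping.single (expo u) (Poly_Mapping.lookup p u * coef u))"
    by (subst poly_mapping_eq_sum_single[of p]) (simp only: sum image_single)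
  then have "Poly_Mapping.lookup (\<sigma> p) (expo v)
      = (\<Sum>u\<in>Poly_Mapping.keys p. if u = v then Poly_Mapping.lookup p u * coef u else 0)"
    by (simp add: lookup_sum lookup_single when_def inj_eq[OF expo_inj])
  then show ?thesis by (simp add: in_keys_iff)
qed

lemma keys_image: "Poly_Mapping.keys (\<sigma> p) = expo ` Poly_Mapping.keys p"
proof -
  have "expo v \<in> Poly_Mapping.keys (\<sigma> p) \<longleftrightarrow> v \<in> Poly_Mapping.keys p" for v
    by (simp add: in_keys_iff lookup_image coef_nonzero)
  then show ?thesis by (metis (no_types, lifting) expo_inv_simps(1) image_iff set_eqI)
qed

lemma keys_inv_image: "Poly_Mapping.keys (inv \<sigma> p) = inv expo ` Poly_Mapping.keys p"
  using keys_image[of "inv \<sigma> p"] by (simp add: image_image)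

lemma keys_funpow: "Poly_Mapping.keys ((\<sigma> ^^ m) p) = (expo ^^ m) ` Poly_Mapping.keys p"
  by (induction m) (auto simp: keys_image)

lemma keys_inv_funpow: "Poly_Mapping.keys ((inv \<sigma> ^^ m) p) = (inv expo ^^ m) ` Poly_Mapping.keys p"
  by (induction m) (auto simp: keys_inv_image)

lemma keys_ipow: "Poly_Mapping.keys (ipow \<sigma> i p) = ipow expo i ` Poly_Mapping.keys p"
  by (simp add: ipow_def keys_funpow keys_inv_funpow)

lemma ipow_zero: "ipow \<sigma> i 0 = 0"
  using keys_ipow[of i 0] by simp

lemma funpow_single:
  assumes "c \<noteq> 0"
  shows "\<exists>d. d \<noteq> 0 \<and> (\<sigma> ^^ m) (Poly_Mapping.single v c) = Poly_Mapping.single ((expo ^^ m) v) d"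
proof (induction m)
  case 0
  then show ?case using assms by auto
next
  case (Suc m)
  then obtain d where "d \<noteq> 0"
    "(\<sigma> ^^ m) (Poly_Mapping.single v c) = Poly_Mapping.single ((expo ^^ m) v) d" by blast
  then show ?case
    by (intro exI[of _ "d * coef ((expo ^^ m) v)"]) (simp add: image_single coef_nonzero)
qed

lemma expo_funpow_add: "(expo ^^ m) (u + w) = (expo ^^ m) u + (expo ^^ m) w"
  by (induction m) (simp_all only: funpow.simps o_apply id_apply expo_add)

lemma expo_funpow_times: "(expo ^^ m) (\<lambda>i. int t * v i) = (\<lambda>i. int t * (expo ^^ m) v i)"
  by (rule additive_nat_times) (rule expo_funpow_add)

section \<open>Matrix powers and iterates of the exponent map\<close>

lemma sigma_matrix_entry: "sigma_matrix \<sigma> $ i $ j = expo (unit_vec j) i"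
  by (simp add: sigma_matrix_def expo_def lvar_eq_single)

text \<open>The dictionary between matrices and exponents: column \<open>j\<close> of the power is
  the exponent of the \<open>m\<close>-th image of \<open>z_j\<close>. It moves conditions (c) and
  (d) to iterates of \<open>expo\<close>.\<close>

lemma mat_pow_entry: "mat_pow (sigma_matrix \<sigma>) m $ i $ j = (expo ^^ m) (unit_vec j) i"
proof (induction m arbitrary: i)
  case 0
  then show ?case by (simp add: mat_def unit_vec_def)
next
  case (Suc m)
  have "mat_pow (sigma_matrix \<sigma>) (Suc m) $ i $ j
      = (\<Sum>l\<in>UNIV. expo (unit_vec l) i * (expo ^^ m) (unit_vec j) l)"
    by (simp add: matrix_matrix_mult_def sigma_matrix_entry Suc)
  also have "\<dots> = expo ((expo ^^ m) (unit_vec j)) i"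
    by (rule additive_int_combination[OF expo_add, symmetric])
  finally show ?case by simp
qed

lemma mat_pow_eq_1_iff: "mat_pow (sigma_matrix \<sigma>) m = mat 1 \<longleftrightarrow> expo ^^ m = id"
proof
  assume *: "mat_pow (sigma_matrix \<sigma>) m = mat 1"
  have "(expo ^^ m) (unit_vec j) i = unit_vec j i" for i j
    using arg_cong[OF *, of "\<lambda>A. A $ i $ j"] by (simp add: mat_pow_entry mat_def unit_vec_def)
  then have "(expo ^^ m) v i = v i" for v i
    using additive_int_combination[of "expo ^^ m" v i, OF expo_funpow_add]
      additive_int_combination[of id v i] by simp
  then show "expo ^^ m = id" by (simp add: fun_eq_iff)
next
  assume "expo ^^ m = id"
  then show "mat_pow (sigma_matrix \<sigma>) m = mat 1"
    by (simp add: vec_eq_iff mat_pow_entry mat_def unit_vec_def)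
qed

end

section \<open>Finite order, boundedness and local algebraicity\<close>

lemma subspace_keys_subset: "lau.subspace {p :: ('n, 'k::field) laurent. Poly_Mapping.keys p \<subseteq> X}"
  unfolding lau.subspace_def
proof (intro conjI ballI allI)
  fix p q :: "('n, 'k) laurent"
  assume "p \<in> {p. Poly_Mapping.keys p \<subseteq> X}" "q \<in> {p. Poly_Mapping.keys p \<subseteq> X}"
  then show "p + q \<in> {p. Poly_Mapping.keys p \<subseteq> X}" using keys_add[of p q] by blast
qed (auto simp: in_keys_iff)

text \<open>Supplies the finite spanning set of the stable subspace in the proof of local
  algebraicity.\<close>

lemma keys_subset_eq_span:
  assumes "finite Y"
  shows "{p :: ('n, 'k::field) laurent. Poly_Mapping.keys p \<subseteq> Y}
    = lau.span ((\<lambda>v. Poly_Mapping.single v 1) ` Y)"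
proof
  show "lau.span ((\<lambda>v. Poly_Mapping.single v 1) ` Y) \<subseteq> {p :: ('n, 'k) laurent. Poly_Mapping.keys p \<subseteq> Y}"
    by (rule lau.span_minimal[OF _ subspace_keys_subset]) auto
  show "{p :: ('n, 'k) laurent. Poly_Mapping.keys p \<subseteq> Y} \<subseteq> lau.span ((\<lambda>v. Poly_Mapping.single v 1) ` Y)"
  proof
    fix p :: "('n, 'k) laurent" assume p: "p \<in> {p. Poly_Mapping.keys p \<subseteq> Y}"
    have "(\<Sum>v\<in>Poly_Mapping.keys p. Poly_Mapping.single v (Poly_Mapping.lookup p v))
        \<in> lau.span ((\<lambda>v. Poly_Mapping.single v 1) ` Y)"
    proof (rule lau.span_sum)
      fix v assume "v \<in> Poly_Mapping.keys p"
      then have "lscale (Poly_Mapping.lookup p v) (Poly_Mapping.single v 1)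
          \<in> lau.span ((\<lambda>v. Poly_Mapping.single v 1) ` Y)"
        using p by (intro lau.span_scale lau.span_base) auto
      then show "Poly_Mapping.single v (Poly_Mapping.lookup p v) \<in> lau.span ((\<lambda>v. Poly_Mapping.single v 1) ` Y)"
        by simp
    qed
    then show "p \<in> lau.span ((\<lambda>v. Poly_Mapping.single v 1) ` Y)"
      by (subst poly_mapping_eq_sum_single)
  qed
qed

context laurent_aut
begin

lemma expo_funpow_eqI:
  assumes "\<And>j k. (expo ^^ s) (unit_vec j) k = (expo ^^ t) (unit_vec j) k"
  shows "expo ^^ s = expo ^^ t"
proof (intro ext)
  fix v k
  show "(expo ^^ s) v k = (expo ^^ t) v k"
    using additive_int_combination[of "expo ^^ s" v k, OF expo_funpow_add]
      additive_int_combination[of "expo ^^ t" v k, OF expo_funpow_add] assms by simp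
qed

text \<open>Pigeonhole: there are only \<open>(2q+1)^(n\<^sup>2)\<close> matrices with entries in \<open>[-q, q]\<close>, and two equal
  powers of an invertible matrix force finite order.\<close>

lemma infinite_order_large_entry:
  assumes inf: "\<And>m. m \<ge> 1 \<Longrightarrow> expo ^^ m \<noteq> id"
  shows "\<exists>i\<le>(2 * q + 1) ^ (CARD('n) * CARD('n)). \<exists>j k. int q < \<bar>(expo ^^ i) (unit_vec j) k\<bar>"
proof (rule ccontr)
  define K where "K = (2 * q + 1) ^ (CARD('n) * CARD('n))"
  define M where "M = (\<lambda>i. \<lambda>(j, k). (expo ^^ i) (unit_vec j) k)"
  assume "\<not> ?thesis"
  then have "\<bar>(expo ^^ i) (unit_vec j) k\<bar> \<le> int q" if "i \<le> K" for i j k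
    using that unfolding K_def by (meson not_less)
  then have le: "(expo ^^ i) (unit_vec j) k \<in> {- int q..int q}" if "i \<le> K" for i j k
    unfolding atLeastAtMost_iff using that by (metis abs_le_iff minus_le_iff)
  have "M ` {..K} \<subseteq> PiE UNIV (\<lambda>_. {- int q..int q})"
  proof (intro image_subsetI PiE_I)
    fix i x assume "i \<in> {..K}"
    then show "M i x \<in> {- int q..int q}"
      using le[of i "fst x" "snd x"] by (simp add: M_def case_prod_beta)
  qed auto
  moreover have fin: "finite (PiE (UNIV :: ('n \<times> 'n) set) (\<lambda>_. {- int q..int q}))"
    by (intro finite_PiE) auto
  moreover have "card (PiE (UNIV :: ('n \<times> 'n) set) (\<lambda>_. {- int q..int q})) = K"
  proof -
    have "card {- int q..int q} = 2 * q + 1" by simp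
    then show ?thesis by (simp add: card_PiE K_def del: card_atLeastAtMost_int)
  qed
  \<comment> \<open>The index set \<open>{..K}\<close> has \<open>K + 1\<close> elements, one more
    than the number of available matrices.\<close>
  ultimately have "\<not> inj_on M {..K}"
    using card_inj_on_le[of M "{..K}" "PiE UNIV (\<lambda>_. {- int q..int q})"] by auto
  then obtain s t where st: "s < t" "M s = M t"
    unfolding inj_on_def by (metis linorder_neqE_nat)
  have "expo ^^ s = expo ^^ t"
    by (rule expo_funpow_eqI) (use st(2) in \<open>auto simp: M_def fun_eq_iff\<close>)
  then have "(expo ^^ s) ((expo ^^ (t - s)) v) = (expo ^^ s) v" for v
    using st(1) by (metis comp_apply funpow_add le_add_diff_inverse less_imp_le)
  then have "(expo ^^ (t - s)) v = v" for v
    using inj_fn[OF expo_inj, of s] by (auto dest: injD)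
  then have "expo ^^ (t - s) = id" by (intro ext) simp
  then show False using inf[of "t - s"] st(1) by linarith
qed

lemma funpow_mod_order:
  assumes "expo ^^ m = id"
  shows "(expo ^^ t) v = (expo ^^ (t mod m)) v"
  by (rule funpow_mod_eq[symmetric]) (simp add: assms)

text \<open>With finite order only \<open>m\<close> different iterates occur, so the sum of absolute
  values over one period bounds every entry. Conversely, a bound \<open>N\<close> contradicts the
  pigeonhole lemma at \<open>q = nat N\<close>.\<close>

lemma finite_order_iff_bounded:
  "(\<exists>m\<ge>1. expo ^^ m = id) \<longleftrightarrow> (\<exists>N>0. \<forall>m\<ge>1. \<forall>i j. \<bar>(expo ^^ m) (unit_vec j) i\<bar> < N)"
proof
  assume "\<exists>m\<ge>1. expo ^^ m = id"
  then obtain m where m: "m \<ge> 1" "expo ^^ m = id" by blast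
  define h where "h = (\<lambda>(t, j, i). \<bar>(expo ^^ t) (unit_vec j) i\<bar>)"
  define I where "I = {..<m} \<times> (UNIV :: 'n set) \<times> (UNIV :: 'n set)"
  have "\<bar>(expo ^^ t) (unit_vec j) i\<bar> \<le> (\<Sum>x\<in>I. h x)" for t i j
  proof -
    have "h (t mod m, j, i) \<le> (\<Sum>x\<in>I. h x)"
      by (rule member_le_sum) (use m in \<open>auto simp: I_def h_def\<close>)
    then show ?thesis by (simp add: h_def flip: funpow_mod_order[OF m(2)])
  qed
  moreover have "(\<Sum>x\<in>I. h x) \<ge> 0" by (rule sum_nonneg) (auto simp: h_def)
  ultimately show "\<exists>N>0. \<forall>m\<ge>1. \<forall>i j. \<bar>(expo ^^ m) (unit_vec j) i\<bar> < N"
    by (intro exI[of _ "(\<Sum>x\<in>I. h x) + 1"]) (simp add: zle_add1_eq_le)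
next
  assume "\<exists>N>0. \<forall>m\<ge>1. \<forall>i j. \<bar>(expo ^^ m) (unit_vec j) i\<bar> < N"
  then obtain N where N: "N > 0" "\<And>m i j. m \<ge> 1 \<Longrightarrow> \<bar>(expo ^^ m) (unit_vec j) i\<bar> < N" by blast
  show "\<exists>m\<ge>1. expo ^^ m = id"
  proof (rule ccontr)
    assume "\<not> ?thesis"
    then obtain i j k where ijk: "int (nat N) < \<bar>(expo ^^ i) (unit_vec j) k\<bar>"
      using infinite_order_large_entry[of "nat N"] by blast
    \<comment> \<open>The bound is assumed for positive powers only; at power 0 the entries are at
      most 1, while \<open>N\<close> is at least 1.\<close>
    have "i \<noteq> 0"
    proof
      assume "i = 0"
      then show False using ijk N(1) by (simp add: unit_vec_def split: if_splits)
    qed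
    then show False using N(1) N(2)[of i j k] ijk by auto
  qed
qed

text \<open>A stable finite-dimensional space containing the variables has finite total support, and
  this support contains the \<open>expo\<close>-orbits of all unit vectors, which are thus bounded.
  Conversely, with finite order the support of a finite set is closed up to a finite union of
  orbits, and the polynomials supported there form a stable space.\<close>

lemma locally_algebraic_iff_finite_order: "locally_algebraic \<sigma> \<longleftrightarrow> (\<exists>m\<ge>1. expo ^^ m = id)"
proof
  assume la: "locally_algebraic \<sigma>"
  have "\<exists>S. finite S \<and> lau.span (range lvar :: ('n, 'k) laurent set) = lau.span S"
    by (intro exI[of _ "range lvar"]) simp
  from la[unfolded locally_algebraic_def, THEN spec, THEN mp, OF this]
  obtain T where T: "finite T" "lau.span (range lvar) \<subseteq> lau.span T" "\<sigma> ` lau.span T = lau.span T"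
    by (elim exE conjE) simp
  define X where "X = (\<Union>p\<in>T. Poly_Mapping.keys p)"
  have "finite X" using T(1) by (simp add: X_def)
  have span: "Poly_Mapping.keys p \<subseteq> X" if "p \<in> lau.span T" for p
    using lau.span_minimal[of T "{p. Poly_Mapping.keys p \<subseteq> X}", OF _ subspace_keys_subset] that
    by (auto simp: X_def)
  have "(\<sigma> ^^ m) (lvar j) \<in> lau.span T" for m j
  proof (induction m)
    case 0
    then show ?case using T(2) lau.span_base[of "lvar j" "range lvar"] by auto
  next
    case (Suc m)
    then show ?case using T(3) by auto
  qed
  then have mem: "(expo ^^ m) (unit_vec j) \<in> X" for m j
    using span[of "(\<sigma> ^^ m) (lvar j)"] by (auto simp: keys_funpow lvar_eq_single)
  have bd: "\<bar>v i\<bar> \<le> (\<Sum>v\<in>X. \<Sum>i\<in>UNIV. \<bar>v i\<bar>)" if "v \<in> X" for v i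
  proof -
    have "\<bar>v i\<bar> \<le> (\<Sum>i\<in>UNIV. \<bar>v i\<bar>)" by (rule member_le_sum) auto
    also have "\<dots> \<le> (\<Sum>v\<in>X. \<Sum>i\<in>UNIV. \<bar>v i\<bar>)"
      by (rule member_le_sum) (use that \<open>finite X\<close> in \<open>auto intro: sum_nonneg\<close>)
    finally show ?thesis .
  qed
  have "(\<Sum>v\<in>X. \<Sum>i\<in>UNIV. \<bar>v i\<bar>) \<ge> 0" by (intro sum_nonneg) auto
  then have "\<exists>N>0. \<forall>m\<ge>1. \<forall>i j. \<bar>(expo ^^ m) (unit_vec j) i\<bar> < N"
    using bd[OF mem] by (intro exI[of _ "(\<Sum>v\<in>X. \<Sum>i\<in>UNIV. \<bar>v i\<bar>) + 1"]) (auto simp: zle_add1_eq_le)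
  then show "\<exists>m\<ge>1. expo ^^ m = id" by (rule finite_order_iff_bounded[THEN iffD2])
next
  assume "\<exists>m\<ge>1. expo ^^ m = id"
  then obtain m where m: "m \<ge> 1" "expo ^^ m = id" by blast
  show "locally_algebraic \<sigma>"
    unfolding locally_algebraic_def
  proof (intro allI impI, elim exE conjE)
    fix W S :: "('n, 'k) laurent set" assume S: "finite S" and W: "W = lau.span S"
    define X where "X = (\<Union>p\<in>S. Poly_Mapping.keys p)"
    define Y where "Y = (\<Union>t<m. (expo ^^ t) ` X)"
    have Y_iff: "v \<in> Y \<longleftrightarrow> (\<exists>t. \<exists>u\<in>X. v = (expo ^^ t) u)" for v
    proof
      assume "\<exists>t. \<exists>u\<in>X. v = (expo ^^ t) u"
      then obtain t u where "u \<in> X" "v = (expo ^^ t) u" by blast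
      moreover have "t mod m < m" using m(1) by simp
      ultimately show "v \<in> Y" unfolding Y_def using funpow_mod_order[OF m(2), of t u] by blast
    qed (auto simp: Y_def)
    have fin: "finite Y" using S by (auto simp: X_def Y_def)
    have "expo ` Y \<subseteq> Y"
    proof
      fix w assume "w \<in> expo ` Y"
      then obtain t u where "u \<in> X" "w = (expo ^^ Suc t) u" by (auto simp: Y_iff)
      then show "w \<in> Y" unfolding Y_iff by blast
    qed
    then have eq: "expo ` Y = Y"
      using fin expo_inj by (metis endo_inj_surj inj_on_subset subset_UNIV)
    then have eq': "inv expo ` Y = Y"
      by (metis expo_bij bij_is_inj image_inv_f_f)
    have XY: "X \<subseteq> Y"
      using Y_iff[of "(expo ^^ 0) _"] by (metis funpow_0 subsetI)
    let ?U = "{p :: ('n, 'k) laurent. Poly_Mapping.keys p \<subseteq> Y}"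
    have "W \<subseteq> ?U"
      unfolding W by (rule lau.span_minimal[OF _ subspace_keys_subset]) (use XY in \<open>auto simp: X_def\<close>)
    moreover have "\<sigma> ` ?U = ?U"
    proof (intro equalityI subsetI)
      fix p assume "p \<in> \<sigma> ` ?U"
      then obtain q where "p = \<sigma> q" "Poly_Mapping.keys q \<subseteq> Y" by blast
      then have "Poly_Mapping.keys p \<subseteq> expo ` Y" by (simp only: keys_image image_mono)
      then show "p \<in> ?U" using eq by simp
    next
      fix p assume "p \<in> ?U"
      then have "Poly_Mapping.keys (inv \<sigma> p) \<subseteq> inv expo ` Y"
        unfolding keys_inv_image by (intro image_mono) simp
      then have "inv \<sigma> p \<in> ?U" using eq' by simp
      then show "p \<in> \<sigma> ` ?U" by (metis image_eqI inv_simps(1))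
    qed
    ultimately show "\<exists>U. (\<exists>T. finite T \<and> U = lau.span T) \<and> W \<subseteq> U \<and> \<sigma> ` U = U"
      using keys_subset_eq_span[OF fin] fin by (metis finite_imageI)
  qed
qed

end

section \<open>Supports in the generalized Weyl algebra\<close>

text \<open>The span of the monomials z^v times a power of \<open>x\<close> or \<open>y\<close> of
  degree at most \<open>D\<close>, with \<open>v\<close> in \<open>T\<close>. Describing it by
  coefficients makes closure under linear combinations immediate.\<close>

definition supp_box :: "int \<Rightarrow> ('n \<Rightarrow> int) set \<Rightarrow> ('n, 'k::field) laurent gwa set" where
  "supp_box D T = {F. \<forall>m v. Poly_Mapping.lookup (Poly_Mapping.lookup F m) v \<noteq> 0 \<longrightarrow> \<bar>m\<bar> \<le> D \<and> v \<in> T}"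

lemma supp_boxD:
  assumes "F \<in> supp_box D T" "m \<in> Poly_Mapping.keys F"
  shows "\<bar>m\<bar> \<le> D" "Poly_Mapping.keys (Poly_Mapping.lookup F m) \<subseteq> T"
proof -
  have "Poly_Mapping.keys (Poly_Mapping.lookup F m) \<noteq> {}"
    using assms(2) by (simp add: in_keys_iff)
  then obtain v where "v \<in> Poly_Mapping.keys (Poly_Mapping.lookup F m)" by blast
  then show "\<bar>m\<bar> \<le> D" using assms(1) by (auto simp: supp_box_def in_keys_iff)
  show "Poly_Mapping.keys (Poly_Mapping.lookup F m) \<subseteq> T"
    using assms(1) by (auto simp: supp_box_def in_keys_iff)
qed

lemma supp_box_mono: "D \<le> D' \<Longrightarrow> T \<subseteq> T' \<Longrightarrow> supp_box D T \<subseteq> supp_box D' T'"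
  by (fastforce simp: supp_box_def)

lemma subspace_supp_box: "gwa.subspace (supp_box D T :: ('n, 'k::field) laurent gwa set)"
  unfolding gwa.subspace_def
proof (intro conjI ballI allI)
  fix F G :: "('n, 'k) laurent gwa" assume "F \<in> supp_box D T" "G \<in> supp_box D T"
  then show "F + G \<in> supp_box D T"
    unfolding supp_box_def by (auto simp: lookup_add) (metis add.right_neutral)+
qed (auto simp: supp_box_def)

lemma single_sum: "Poly_Mapping.single m (\<Sum>x\<in>A. g x) = (\<Sum>x\<in>A. Poly_Mapping.single m (g x))"
  by (induction A rule: infinite_finite_induct) (auto simp: single_add)

lemma gwa_scale_single: "gwa_scale c (Poly_Mapping.single m p) = Poly_Mapping.single m (lscale c p)"
  by (rule poly_mapping_eqI, rule poly_mapping_eqI) (auto simp: lookup_single when_def)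

text \<open>Turns control of supports into control of dimension: at most \<open>2 D + 1\<close>
  degrees times the size of \<open>T\<close>.\<close>

lemma supp_box_subset_span:
  "supp_box D T \<subseteq> (gwa.span ((\<lambda>(m, v). Poly_Mapping.single m (Poly_Mapping.single v 1)) ` ({- D..D} \<times> T))
    :: ('n, 'k::field) laurent gwa set)"
proof
  let ?E = "(\<lambda>(m, v). Poly_Mapping.single m (Poly_Mapping.single v 1)) ` ({- D..D} \<times> T)
    :: ('n, 'k) laurent gwa set"
  fix F :: "('n, 'k) laurent gwa" assume F: "F \<in> supp_box D T"
  have "F = (\<Sum>m\<in>Poly_Mapping.keys F. Poly_Mapping.single m (Poly_Mapping.lookup F m))"
    by (rule poly_mapping_eq_sum_single)
  also have "\<dots> = (\<Sum>m\<in>Poly_Mapping.keys F. \<Sum>v\<in>Poly_Mapping.keys (Poly_Mapping.lookup F m).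
      Poly_Mapping.single m (Poly_Mapping.single v (Poly_Mapping.lookup (Poly_Mapping.lookup F m) v)))"
    unfolding single_sum[symmetric] poly_mapping_eq_sum_single[symmetric] ..
  also have "\<dots> \<in> gwa.span ?E"
  proof (intro gwa.span_sum)
    fix m v assume mv: "m \<in> Poly_Mapping.keys F" "v \<in> Poly_Mapping.keys (Poly_Mapping.lookup F m)"
    have "gwa_scale (Poly_Mapping.lookup (Poly_Mapping.lookup F m) v)
        (Poly_Mapping.single m (Poly_Mapping.single v 1)) \<in> gwa.span ?E"
      using supp_boxD[OF F mv(1)] mv(2)
      by (intro gwa.span_scale gwa.span_base image_eqI[of _ _ "(m, v)"]) auto
    then show "Poly_Mapping.single m (Poly_Mapping.single v (Poly_Mapping.lookup (Poly_Mapping.lookup F m) v))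
        \<in> gwa.span ?E"
      by (simp add: gwa_scale_single)
  qed
  finally show "F \<in> gwa.span ?E" .
qed

lemma finite_span_supp_box:
  fixes S :: "('n, 'k::field) laurent gwa set"
  assumes "finite S"
  obtains D T where "D \<ge> 0" "finite T" "gwa.span S \<subseteq> supp_box D T"
proof -
  define T where "T = (\<Union>F\<in>S. \<Union>m\<in>Poly_Mapping.keys F. Poly_Mapping.keys (Poly_Mapping.lookup F m))"
  define D where "D = (\<Sum>F\<in>S. \<Sum>m\<in>Poly_Mapping.keys F. \<bar>m\<bar>)"
  have D: "\<bar>m\<bar> \<le> D" if "F \<in> S" "m \<in> Poly_Mapping.keys F" for F m
  proof -
    have "\<bar>m\<bar> \<le> (\<Sum>m\<in>Poly_Mapping.keys F. \<bar>m\<bar>)"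
      by (rule member_le_sum) (use that in auto)
    also have "\<dots> \<le> D" unfolding D_def
      by (rule member_le_sum) (use that assms in \<open>auto intro: sum_nonneg\<close>)
    finally show ?thesis .
  qed
  have "F \<in> supp_box D T" if "F \<in> S" for F
  proof -
    have "m \<in> Poly_Mapping.keys F" if "Poly_Mapping.lookup (Poly_Mapping.lookup F m) v \<noteq> 0" for m v
      using that by (auto simp: in_keys_iff)
    then show ?thesis using that D by (fastforce simp: supp_box_def T_def in_keys_iff)
  qed
  then have "gwa.span S \<subseteq> supp_box D T"
    by (intro gwa.span_minimal subspace_supp_box) auto
  moreover have "finite T" "D \<ge> 0"
    using assms by (auto simp: T_def D_def intro!: sum_nonneg)
  ultimately show ?thesis using that by blast
qed

section \<open>Supports of products and finite-dimensional growth spaces\<close>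

context laurent_aut
begin

text \<open>The target \<open>T''\<close> stays abstract so that the same computation yields both
  mere finiteness for arbitrary \<open>\<sigma>\<close> and linear radius bounds for finite
  order.\<close>

lemma gwa_mult_supp_box:
  assumes F: "F \<in> supp_box D T" and G: "G \<in> supp_box D' T'"
    and T'': "\<And>m l t s c. \<bar>m\<bar> \<le> D \<Longrightarrow> \<bar>l\<bar> \<le> D' \<Longrightarrow> t \<in> T \<Longrightarrow> s \<in> T'
      \<Longrightarrow> c \<in> Poly_Mapping.keys (gwa_coeff \<sigma> a m l) \<Longrightarrow> t + ipow expo m s + c \<in> T''"
  shows "gwa_mult \<sigma> a F G \<in> supp_box (D + D') T''"
  unfolding gwa_mult_def
proof (intro gwa.subspace_sum[OF subspace_supp_box])
  fix m l assume m: "m \<in> Poly_Mapping.keys F" and l: "l \<in> Poly_Mapping.keys G"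
  note Fm = supp_boxD[OF F m] and Gl = supp_boxD[OF G l]
  let ?p = "Poly_Mapping.lookup F m" and ?q = "Poly_Mapping.lookup G l" and ?c = "gwa_coeff \<sigma> a m l"
  have "v \<in> T''" if v: "v \<in> Poly_Mapping.keys (?p * ipow \<sigma> m ?q * ?c)" for v
  proof -
    obtain x c where x: "v = x + c" "x \<in> Poly_Mapping.keys (?p * ipow \<sigma> m ?q)" "c \<in> Poly_Mapping.keys ?c"
      using v keys_mult[of "?p * ipow \<sigma> m ?q" ?c] by blast
    obtain t y where y: "x = t + y" "t \<in> Poly_Mapping.keys ?p" "y \<in> Poly_Mapping.keys (ipow \<sigma> m ?q)"
      using x(2) keys_mult[of ?p "ipow \<sigma> m ?q"] by blast
    obtain s where s: "y = ipow expo m s" "s \<in> Poly_Mapping.keys ?q"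
      using y(3) unfolding keys_ipow by blast
    show ?thesis
      unfolding x(1) y(1) s(1) by (rule T'') (use Fm Gl x(3) y(2) s(2) in blast)+
  qed
  moreover have "\<bar>m + l\<bar> \<le> D + D'" using Fm(1) Gl(1) by linarith
  ultimately show "Poly_Mapping.single (m + l) (?p * ipow \<sigma> m ?q * ?c) \<in> supp_box (D + D') T''"
    unfolding supp_box_def by (auto simp: lookup_single when_def in_keys_iff split: if_splits)
qed

text \<open>One more factor involves only finitely many twists and structure coefficients, so
  supports stay finite for every automorphism, without any control of their size.\<close>

lemma products_finite_support:
  assumes "D \<ge> 0" "finite T" "V \<subseteq> supp_box D T"
  shows "\<exists>T'. finite T' \<and> (\<forall>xs. set xs \<subseteq> V \<and> length xs = i
    \<longrightarrow> gwa_prod_list \<sigma> a xs \<in> supp_box (int i * D) T')"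
proof (induction i)
  case 0
  have "gwa_prod_list \<sigma> a [] \<in> supp_box 0 {0}"
    by (auto simp: gwa_prod_list_def gwa_one_def supp_box_def lookup_single lookup_one when_def split: if_splits)
  then show ?case by (intro exI[of _ "{0}"]) auto
next
  case (Suc i)
  then obtain T' where T': "finite T'"
    "\<And>xs. set xs \<subseteq> V \<Longrightarrow> length xs = i \<Longrightarrow> gwa_prod_list \<sigma> a xs \<in> supp_box (int i * D) T'" by blast
  define T'' where "T'' = (\<lambda>(t, s, c). t + s + c) ` (T \<times> (\<Union>m\<in>{- D..D}. ipow expo m ` T')
    \<times> (\<Union>m\<in>{- D..D}. \<Union>l\<in>{- (int i * D)..int i * D}. Poly_Mapping.keys (gwa_coeff \<sigma> a m l)))"
  have fin: "finite T''" unfolding T''_def using assms T'(1)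
    by (intro finite_imageI finite_cartesian_product finite_UN_I) auto
  have "gwa_prod_list \<sigma> a xs \<in> supp_box (int (Suc i) * D) T''" if xs: "set xs \<subseteq> V" "length xs = Suc i" for xs
  proof -
    obtain F ys where ys: "xs = F # ys" using xs(2) by (cases xs) auto
    have "gwa_mult \<sigma> a F (gwa_prod_list \<sigma> a ys) \<in> supp_box (D + int i * D) T''"
    proof (rule gwa_mult_supp_box)
      show "F \<in> supp_box D T" using xs ys assms by auto
      show "gwa_prod_list \<sigma> a ys \<in> supp_box (int i * D) T'" using xs ys by (intro T'(2)) auto
      fix m l t s c
      assume *: "\<bar>m\<bar> \<le> D" "\<bar>l\<bar> \<le> int i * D" "t \<in> T" "s \<in> T'" "c \<in> Poly_Mapping.keys (gwa_coeff \<sigma> a m l)"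
      have "m \<in> {- D..D}" "l \<in> {- (int i * D)..int i * D}" using *(1,2) by (auto simp: abs_le_iff)
      then have "(t, ipow expo m s, c) \<in> T \<times> (\<Union>m\<in>{- D..D}. ipow expo m ` T')
          \<times> (\<Union>m\<in>{- D..D}. \<Union>l\<in>{- (int i * D)..int i * D}. Poly_Mapping.keys (gwa_coeff \<sigma> a m l))"
        using *(3-5) by blast
      then show "t + ipow expo m s + c \<in> T''"
        unfolding T''_def by (rule rev_image_eqI) (simp only: prod.case)
    qed
    then show ?thesis by (simp add: ys gwa_prod_list_def algebra_simps)
  qed
  then show ?case using fin by blast
qed

lemma growth_space_supp_box:
  assumes "\<And>xs i. i \<le> N \<Longrightarrow> set xs \<subseteq> V \<Longrightarrow> length xs = i \<Longrightarrow> gwa_prod_list \<sigma> a xs \<in> supp_box D T"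
  shows "(\<Union>i\<in>{0..N}. gwa_power_space \<sigma> a V i) \<subseteq> supp_box D T"
  unfolding gwa_power_space_def
  by (intro UN_least gwa.span_minimal subspace_supp_box) (use assms in auto)

text \<open>A dimension is a \<open>card\<close>, which is 0 for infinite sets. An independent set
  therefore gives a lower bound only once the growth space is known to be finite-dimensional, which
  the finite supports \<open>T'\<close> ensure.\<close>

lemma growth_ge_card:
  assumes S: "finite S" and B: "gwa.independent B" "B \<subseteq> (\<Union>i\<in>{0..N}. gwa_power_space \<sigma> a (gwa.span S) i)"
  shows "card B \<le> gwa_growth \<sigma> a (gwa.span S) N"
proof -
  let ?X = "\<Union>i\<in>{0..N}. gwa_power_space \<sigma> a (gwa.span S) i"
  obtain D T where DT: "D \<ge> 0" "finite T" "gwa.span S \<subseteq> supp_box D T"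
    using finite_span_supp_box[OF S] .
  have "\<forall>i. \<exists>T'. finite T' \<and> (\<forall>xs. set xs \<subseteq> gwa.span S \<and> length xs = i
      \<longrightarrow> gwa_prod_list \<sigma> a xs \<in> supp_box (int i * D) T')"
    using products_finite_support[OF DT] by blast
  from choice[OF this] obtain T' where T': "\<And>i. finite (T' i)" "\<And>i xs. set xs \<subseteq> gwa.span S
      \<Longrightarrow> length xs = i \<Longrightarrow> gwa_prod_list \<sigma> a xs \<in> supp_box (int i * D) (T' i)"
    by blast
  have X: "?X \<subseteq> supp_box (int N * D) (\<Union>i\<le>N. T' i)"
  proof (rule growth_space_supp_box)
    fix xs i assume *: "i \<le> N" "set xs \<subseteq> gwa.span S" "length xs = i"
    have "int i * D \<le> int N * D" using * DT(1) by (intro mult_right_mono) auto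
    moreover have "T' i \<subseteq> (\<Union>i\<le>N. T' i)" using * by auto
    ultimately show "gwa_prod_list \<sigma> a xs \<in> supp_box (int N * D) (\<Union>i\<le>N. T' i)"
      using T'(2)[OF *(2,3)] supp_box_mono by blast
  qed
  obtain C where C: "C \<subseteq> ?X" "gwa.independent C" "?X \<subseteq> gwa.span C" "card C = gwa.dim ?X"
    by (rule gwa.basis_exists)
  have "finite C"
  proof -
    have "C \<subseteq> gwa.span ((\<lambda>(m, v). Poly_Mapping.single m (Poly_Mapping.single v 1))
        ` ({- (int N * D)..int N * D} \<times> (\<Union>i\<le>N. T' i)))"
      using C(1) X supp_box_subset_span by blast
    then show ?thesis using gwa.independent_span_bound[OF _ C(2)] T'(1)
      by (metis (no_types, lifting) finite_SigmaI finite_UN_I finite_atLeastAtMost_int finite_atMost finite_imageI)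
  qed
  then have "card B \<le> card C"
    using gwa.independent_span_bound[of C B] B C(3) by blast
  then show ?thesis by (simp add: C(4) gwa_growth_def)
qed

end

section \<open>Upper bound for finite order\<close>

context laurent_aut
begin

text \<open>The ball of radius \<open>R\<close> for the supremum norm taken over the whole forward
  orbit. Taking the supremum over the orbit makes the ball stable under \<open>expo\<close>; for
  finite order every vector lies in some such ball.\<close>

definition orbit_ball :: "int \<Rightarrow> ('n \<Rightarrow> int) set" where
  "orbit_ball R = {v. \<forall>t k. \<bar>(expo ^^ t) v k\<bar> \<le> R}"

lemma orbit_ball_add: "u \<in> orbit_ball R \<Longrightarrow> w \<in> orbit_ball R' \<Longrightarrow> u + w \<in> orbit_ball (R + R')"
  unfolding orbit_ball_def expo_funpow_add mem_Collect_eq plus_fun_apply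
  by (meson abs_triangle_ineq add_mono order_trans)

lemma orbit_ball_mono: "R \<le> R' \<Longrightarrow> orbit_ball R \<subseteq> orbit_ball R'"
  by (auto simp: orbit_ball_def intro: order_trans)

lemma orbit_ball_zero: "R \<ge> 0 \<Longrightarrow> 0 \<in> orbit_ball R"
proof -
  have "(expo ^^ t) 0 = 0" for t
    by (induction t) (simp_all only: funpow.simps o_apply id_apply expo_zero)
  then show "0 \<in> orbit_ball R" if "R \<ge> 0"
    using that by (simp only: orbit_ball_def mem_Collect_eq zero_fun_apply abs_zero simp_thms)
qed

text \<open>The iterate \<open>t = 0\<close> alone places the ball inside the cube
  [-R, R]^n.\<close>

lemma orbit_ball_finite: "finite (orbit_ball R)"
  and card_orbit_ball: "R \<ge> 0 \<Longrightarrow> card (orbit_ball R) \<le> nat (2 * R + 1) ^ CARD('n)"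
proof -
  have sub: "orbit_ball R \<subseteq> PiE UNIV (\<lambda>_. {- R..R})"
  proof
    fix v assume "v \<in> orbit_ball R"
    then have "\<bar>(expo ^^ 0) v k\<bar> \<le> R" for k unfolding orbit_ball_def by blast
    then show "v \<in> PiE UNIV (\<lambda>_. {- R..R})" by (auto simp: abs_le_iff) (metis minus_le_iff)
  qed
  have fin: "finite (PiE (UNIV :: 'n set) (\<lambda>_. {- R..R}))" by (intro finite_PiE) auto
  show "finite (orbit_ball R)" using sub fin by (rule finite_subset)
  show "card (orbit_ball R) \<le> nat (2 * R + 1) ^ CARD('n)"
    using card_mono[OF fin sub] by (simp add: card_PiE algebra_simps)
qed

lemma expo_orbit_ball:
  assumes "v \<in> orbit_ball R"
  shows "(expo ^^ i) v \<in> orbit_ball R"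
  unfolding orbit_ball_def
proof (intro CollectI allI)
  fix t k
  have "(expo ^^ t) ((expo ^^ i) v) = (expo ^^ (t + i)) v" by (simp add: funpow_add)
  then show "\<bar>(expo ^^ t) ((expo ^^ i) v) k\<bar> \<le> R" using assms by (auto simp: orbit_ball_def)
qed

text \<open>Finite order makes the inverse of \<open>expo\<close> the forward iterate
  \<open>m - 1\<close>, so negative powers preserve the ball too.\<close>

lemma ipow_expo_orbit_ball:
  assumes m: "m \<ge> 1" "expo ^^ m = id" and v: "v \<in> orbit_ball R"
  shows "ipow expo i v \<in> orbit_ball R"
proof -
  have inv: "inv expo w = (expo ^^ (m - 1)) w" for w
  proof -
    have "expo ((expo ^^ (m - 1)) w) = w"
      using m by (metis One_nat_def Suc_pred comp_apply funpow.simps(2) id_apply less_eq_Suc_le)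
    then show ?thesis by (metis expo_inv_simps(2))
  qed
  have "(inv expo ^^ t) v \<in> orbit_ball R" for t
    by (induction t) (auto simp: v inv expo_orbit_ball)
  then show ?thesis using v by (auto simp: ipow_def expo_orbit_ball)
qed

lemma finite_subset_orbit_ball:
  assumes m: "m \<ge> 1" "expo ^^ m = id" and T: "finite T"
  obtains R where "R \<ge> 0" "T \<subseteq> orbit_ball R"
proof
  define h where "h = (\<lambda>(v, t, k). \<bar>(expo ^^ t) v k\<bar>)"
  let ?I = "T \<times> {..<m} \<times> (UNIV :: 'n set)"
  show "(\<Sum>x\<in>?I. h x) \<ge> 0" by (rule sum_nonneg) (auto simp: h_def)
  have "\<bar>(expo ^^ t) v k\<bar> \<le> (\<Sum>x\<in>?I. h x)" if "v \<in> T" for v t k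
  proof -
    have "h (v, t mod m, k) \<le> (\<Sum>x\<in>?I. h x)"
      by (rule member_le_sum) (use m that T in \<open>auto simp: h_def\<close>)
    then show ?thesis by (simp add: h_def flip: funpow_mod_order[OF m(2)])
  qed
  then show "T \<subseteq> orbit_ball (\<Sum>x\<in>?I. h x)" by (auto simp: orbit_ball_def)
qed

lemma keys_prod_orbit_ball:
  assumes "finite I" "\<And>i. i \<in> I \<Longrightarrow> Poly_Mapping.keys (g i) \<subseteq> orbit_ball R"
  shows "Poly_Mapping.keys (prod g I) \<subseteq> orbit_ball (int (card I) * R)"
  using assms
proof (induction)
  case empty
  then show ?case using orbit_ball_zero[of 0] by simp
next
  case (insert b I)
  have "v \<in> orbit_ball (R + int (card I) * R)" if v: "v \<in> Poly_Mapping.keys (g b * prod g I)" for v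
  proof -
    obtain x y where "v = x + y" "x \<in> Poly_Mapping.keys (g b)" "y \<in> Poly_Mapping.keys (prod g I)"
      using v keys_mult[of "g b" "prod g I"] by blast
    then show ?thesis using insert orbit_ball_add by blast
  qed
  then show ?case using insert.hyps by (auto simp: algebra_simps)
qed

text \<open>A structure coefficient is 1 or a product of at most |i| twists of \<open>a\<close>, all
  in one ball. The bound uses the left degree only: products are built from the left, where the
  degree is that of a single factor, so each multiplication adds a constant radius.\<close>

lemma keys_gwa_coeff_orbit_ball:
  assumes m: "m \<ge> 1" "expo ^^ m = id" and a: "Poly_Mapping.keys a \<subseteq> orbit_ball R" and R: "R \<ge> 0"
  shows "Poly_Mapping.keys (gwa_coeff \<sigma> a i l) \<subseteq> orbit_ball (\<bar>i\<bar> * R)"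
proof -
  have ip: "Poly_Mapping.keys (ipow \<sigma> j a) \<subseteq> orbit_ball R" for j
    using ipow_expo_orbit_ball[OF m] a by (auto simp: keys_ipow)
  have pr: "Poly_Mapping.keys (\<Prod>j\<in>I. ipow \<sigma> (g j) a) \<subseteq> orbit_ball (\<bar>i\<bar> * R)"
    if "finite I" "int (card I) \<le> \<bar>i\<bar>" for I and g :: "int \<Rightarrow> int"
    using keys_prod_orbit_ball[OF that(1), of "\<lambda>j. ipow \<sigma> (g j) a" R, OF ip]
      orbit_ball_mono[OF mult_right_mono[OF that(2) R]] by blast
  show ?thesis
    using pr[of "{i - min i (- l) + 1..i}" "\<lambda>j. j"] pr[of "{- i - min (- i) l..- i - 1}" "\<lambda>j. - j"]
      orbit_ball_zero[of "\<bar>i\<bar> * R"] R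
    by (auto simp: gwa_coeff_def Let_def)
qed

lemma growth_polynomial_bound:
  assumes m: "m \<ge> 1" "expo ^^ m = id" and S: "finite S"
  obtains C where "C \<ge> 1" "\<And>N. N \<ge> 1 \<Longrightarrow> real (gwa_growth \<sigma> a (gwa.span S) N) \<le> C * real N ^ (CARD('n) + 1)"
proof -
  obtain D T where DT: "D \<ge> 0" "finite T" "gwa.span S \<subseteq> supp_box D T"
    using finite_span_supp_box[OF S] .
  obtain R1 where R1: "R1 \<ge> 0" "T \<subseteq> orbit_ball R1"
    using finite_subset_orbit_ball[OF m DT(2)] .
  obtain R2 where R2: "R2 \<ge> 0" "Poly_Mapping.keys a \<subseteq> orbit_ball R2"
    using finite_subset_orbit_ball[OF m finite_keys[of a]] .
  \<comment> \<open>The radius gained per factor: \<open>R1\<close> from its own exponents and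
    \<open>D * R2\<close> from the structure coefficient it creates.\<close>
  define R where "R = R1 + D * R2"
  have R: "R \<ge> 0" using R1 R2 DT by (simp add: R_def)
  have prod: "gwa_prod_list \<sigma> a xs \<in> supp_box (int (length xs) * D) (orbit_ball (int (length xs) * R))"
    if "set xs \<subseteq> gwa.span S" for xs
    using that
  proof (induction xs)
    case Nil
    show ?case using orbit_ball_zero[of 0]
      by (auto simp: gwa_prod_list_def gwa_one_def supp_box_def lookup_single lookup_one when_def split: if_splits)
  next
    case (Cons F xs)
    let ?i = "int (length xs)"
    have "gwa_mult \<sigma> a F (gwa_prod_list \<sigma> a xs) \<in> supp_box (D + ?i * D) (orbit_ball (R1 + ?i * R + D * R2))"
    proof (rule gwa_mult_supp_box)
      show "F \<in> supp_box D T" using Cons.prems DT(3) by auto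
      show "gwa_prod_list \<sigma> a xs \<in> supp_box (?i * D) (orbit_ball (?i * R))"
        using Cons by simp
      fix j l t s c
      assume *: "\<bar>j\<bar> \<le> D" "t \<in> T" "s \<in> orbit_ball (?i * R)" "c \<in> Poly_Mapping.keys (gwa_coeff \<sigma> a j l)"
      have "c \<in> orbit_ball (D * R2)"
        using keys_gwa_coeff_orbit_ball[OF m R2(2,1)] orbit_ball_mono[OF mult_right_mono[OF *(1) R2(1)]] *(4)
        by blast
      then show "t + ipow expo j s + c \<in> orbit_ball (R1 + ?i * R + D * R2)"
        using *(2) R1(2) ipow_expo_orbit_ball[OF m *(3)] by (intro orbit_ball_add) auto
    qed
    then show ?case by (simp add: gwa_prod_list_def algebra_simps R_def)
  qed
  have growth: "gwa_growth \<sigma> a (gwa.span S) N \<le> nat (2 * (int N * D) + 1) * nat (2 * (int N * R) + 1) ^ CARD('n)" for N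
  proof -
    let ?X = "\<Union>i\<in>{0..N}. gwa_power_space \<sigma> a (gwa.span S) i"
    let ?f = "\<lambda>(m, v). Poly_Mapping.single m (Poly_Mapping.single v 1) :: ('n, 'k) laurent gwa"
    let ?P = "{- (int N * D)..int N * D} \<times> orbit_ball (int N * R)"
    have "?X \<subseteq> supp_box (int N * D) (orbit_ball (int N * R))"
    proof (rule growth_space_supp_box)
      fix xs i assume *: "i \<le> N" "set xs \<subseteq> gwa.span S" "length xs = i"
      have "int i * D \<le> int N * D" "int i * R \<le> int N * R"
        using * DT(1) R by (auto intro!: mult_right_mono)
      then show "gwa_prod_list \<sigma> a xs \<in> supp_box (int N * D) (orbit_ball (int N * R))"
        using prod[OF *(2)] *(3) supp_box_mono orbit_ball_mono by blast
    qed
    then have "?X \<subseteq> gwa.span (?f ` ?P)" using supp_box_subset_span by blast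
    then have "gwa.dim ?X \<le> card (?f ` ?P)"
      by (rule gwa.dim_le_card) (auto simp: orbit_ball_finite)
    also have "\<dots> \<le> card ?P" by (rule card_image_le) (auto simp: orbit_ball_finite)
    also have "\<dots> = nat (2 * (int N * D) + 1) * card (orbit_ball (int N * R))"
      by (simp add: card_cartesian_product algebra_simps)
    also have "\<dots> \<le> nat (2 * (int N * D) + 1) * nat (2 * (int N * R) + 1) ^ CARD('n)"
      using card_orbit_ball[of "int N * R"] R by (intro mult_left_mono) auto
    finally show ?thesis by (simp add: gwa_growth_def)
  qed
  \<comment> \<open>For \<open>N \<ge> 1\<close> one has 2 N E + 1 <= (2 E + 1) N; this is applied
    once with \<open>E = D\<close> and \<open>n\<close> times with \<open>E = R\<close>.\<close>
  define C where "C = real_of_int (2 * D + 1) * real_of_int (2 * R + 1) ^ CARD('n)"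
  have C: "C \<ge> 1"
  proof -
    have "1 * 1 \<le> real_of_int (2 * D + 1) * real_of_int (2 * R + 1) ^ CARD('n)"
      using DT(1) R by (intro mult_mono one_le_power) auto
    then show ?thesis by (simp add: C_def)
  qed
  have "real (gwa_growth \<sigma> a (gwa.span S) N) \<le> C * real N ^ (CARD('n) + 1)" if N: "N \<ge> 1" for N
  proof -
    have aux: "real (nat (2 * (int N * E) + 1)) \<le> real_of_int (2 * E + 1) * real N" if "E \<ge> 0" for E
      using that N by (simp add: algebra_simps)
    have "real (gwa_growth \<sigma> a (gwa.span S) N)
        \<le> real (nat (2 * (int N * D) + 1) * nat (2 * (int N * R) + 1) ^ CARD('n))"
      using growth of_nat_mono by blast
    also have "\<dots> = real (nat (2 * (int N * D) + 1)) * real (nat (2 * (int N * R) + 1)) ^ CARD('n)"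
      by simp
    also have "\<dots> \<le> (real_of_int (2 * D + 1) * real N) * (real_of_int (2 * R + 1) * real N) ^ CARD('n)"
      using DT(1) R by (intro mult_mono power_mono aux) auto
    also have "\<dots> = C * real N ^ (CARD('n) + 1)"
      by (simp add: C_def power_mult_distrib)
    finally show ?thesis .
  qed
  then show ?thesis using C that by blast
qed

end

section \<open>Lower bound from monomial words\<close>

lemma prod_lvar_power:
  fixes u :: "'n::finite \<Rightarrow> nat"
  shows "(\<Prod>j\<in>UNIV. lvar j ^ u j) = (Poly_Mapping.single (\<lambda>i. int (u i)) 1 :: ('n, 'k::field) laurent)"
proof -
  have "(\<Prod>j\<in>A. lvar j ^ u j)
      = (Poly_Mapping.single (\<lambda>i. if i \<in> A then int (u i) else 0) 1 :: ('n, 'k) laurent)"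
    if "finite A" for A
    using that
  proof induction
    case empty
    have "(\<lambda>i. if i \<in> {} then int (u i) else 0) = (0 :: 'n \<Rightarrow> int)" by auto
    then show ?case by simp
  next
    case (insert b A)
    have "(\<lambda>i. int (u b) * unit_vec b i) + (\<lambda>i. if i \<in> A then int (u i) else 0)
        = (\<lambda>i. if i \<in> insert b A then int (u i) else 0)"
      using insert.hyps by (auto simp: fun_eq_iff unit_vec_def)
    then show ?case
      unfolding prod.insert[OF insert.hyps] insert.IH
      unfolding lvar_power mult_single mult_1 by simp
  qed
  from this[of UNIV] show ?thesis by simp
qed

lemma single_single_inject:
  assumes "Poly_Mapping.single m (Poly_Mapping.single v c) = Poly_Mapping.single m' (Poly_Mapping.single v' c')"
    and "c \<noteq> 0"
  shows "m = m'" "v = v'"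
proof -
  have "Poly_Mapping.lookup (Poly_Mapping.lookup
      (Poly_Mapping.single m' (Poly_Mapping.single v' c')) m) v \<noteq> 0"
    using assms by (metis lookup_single_eq)
  then show "m = m'" "v = v'" by (auto simp: lookup_single when_def split: if_splits)
qed

text \<open>The coefficient at \<open>(m x, v x)\<close> is a linear functional that kills every
  other member of the family but not the one at \<open>x\<close>. Arbitrary nonzero scalars are
  allowed because words determine monomials only up to scalars.\<close>

lemma independent_monomials:
  fixes \<alpha> :: "'i \<Rightarrow> 'k::field" and v :: "'i \<Rightarrow> 'n \<Rightarrow> int"
  assumes inj: "inj_on (\<lambda>x. (m x, v x)) I" and nz: "\<And>x. x \<in> I \<Longrightarrow> \<alpha> x \<noteq> 0"
  defines "f \<equiv> \<lambda>x. Poly_Mapping.single (m x) (Poly_Mapping.single (v x) (\<alpha> x))"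
  shows "inj_on f I" "gwa.independent (f ` I)"
proof -
  show inj_f: "inj_on f I"
  proof (rule inj_onI)
    fix x y assume xy: "x \<in> I" "y \<in> I" "f x = f y"
    then have "m x = m y" "v x = v y"
      using single_single_inject[OF xy(3)[unfolded f_def]] nz by blast+
    then show "x = y" using inj xy by (auto simp: inj_on_def)
  qed
  show "gwa.independent (f ` I)"
    unfolding gwa.dependent_def
  proof (intro notI, elim bexE)
    fix b assume b: "b \<in> f ` I" "b \<in> gwa.span (f ` I - {b})"
    then obtain x where x: "x \<in> I" "b = f x" by blast
    let ?H = "{F :: ('n, 'k) laurent gwa. Poly_Mapping.lookup (Poly_Mapping.lookup F (m x)) (v x) = 0}"
    have "gwa.subspace ?H"
      unfolding gwa.subspace_def by (auto simp: lookup_add)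
    moreover have "f ` I - {b} \<subseteq> ?H"
    proof
      fix F assume "F \<in> f ` I - {b}"
      then obtain y where y: "y \<in> I" "F = f y" "f y \<noteq> f x" using x by blast
      then have "(m x, v x) \<noteq> (m y, v y)" using inj x by (auto simp: inj_on_def)
      then show "F \<in> ?H" by (auto simp: y f_def lookup_single when_def)
    qed
    ultimately have "b \<in> ?H" using b(2) gwa.span_minimal by blast
    then show False using nz[OF x(1)] by (simp add: x f_def)
  qed
qed

section \<open>Words in \<open>x\<close> and the variables\<close>

context laurent_aut
begin

text \<open>Only \<open>x\<close> and the \<open>z_j\<close> occur. Without \<open>y\<close> every
  structure coefficient met is 1, so the words do not depend on \<open>a\<close>, which may even be
  0.\<close>

definition gens :: "('n, 'k) laurent gwa set" where
  "gens = insert (Poly_Mapping.single 1 1) (range (\<lambda>j. Poly_Mapping.single 0 (lvar j)))"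

definition word :: "('n, 'k) laurent \<Rightarrow> nat \<Rightarrow> ('n, 'k) laurent gwa \<Rightarrow> bool" where
  "word a n F \<longleftrightarrow> (\<exists>xs. set xs \<subseteq> gens \<and> length xs = n \<and> gwa_prod_list \<sigma> a xs = F)"

lemma gwa_mult_single:
  "gwa_mult \<sigma> a (Poly_Mapping.single m p) (Poly_Mapping.single l q)
    = Poly_Mapping.single (m + l) (p * ipow \<sigma> m q * gwa_coeff \<sigma> a m l)"
  by (simp add: gwa_mult_def ipow_zero)

lemma word_0: "word a 0 (Poly_Mapping.single 0 1)"
  by (simp add: word_def gwa_prod_list_def gwa_one_def)

lemma word_Suc: "word a n F \<Longrightarrow> G \<in> gens \<Longrightarrow> word a (Suc n) (gwa_mult \<sigma> a G F)"
  unfolding word_def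
proof (elim exE conjE)
  fix xs assume "G \<in> gens" "set xs \<subseteq> gens" "length xs = n" "gwa_prod_list \<sigma> a xs = F"
  then show "\<exists>xs. set xs \<subseteq> gens \<and> length xs = Suc n \<and> gwa_prod_list \<sigma> a xs = gwa_mult \<sigma> a G F"
    by (intro exI[of _ "G # xs"]) (auto simp: gwa_prod_list_def)
qed

lemma word_lvar:
  assumes "word a n (Poly_Mapping.single r q)"
  shows "word a (Suc n) (Poly_Mapping.single r (lvar j * q))"
  using word_Suc[OF assms, of "Poly_Mapping.single 0 (lvar j)"]
  by (simp add: gens_def gwa_mult_single ipow_def gwa_coeff_def)

text \<open>The relation x q = sigma(q) x carries the new letter past the coefficient.\<close>

lemma word_x:
  assumes "word a n (Poly_Mapping.single (int r) q)"
  shows "word a (Suc n) (Poly_Mapping.single (int (Suc r)) (\<sigma> q))"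
  using word_Suc[OF assms, of "Poly_Mapping.single 1 1"]
  by (simp add: gens_def gwa_mult_single ipow_def gwa_coeff_def)

lemma word_x_power:
  assumes "word a n (Poly_Mapping.single (int r) q)"
  shows "word a (n + i) (Poly_Mapping.single (int (r + i)) ((\<sigma> ^^ i) q))"
proof (induction i)
  case 0
  then show ?case using assms by simp
next
  case (Suc i)
  then show ?case using word_x[OF Suc] by simp
qed

lemma word_lvar_power:
  assumes "word a n (Poly_Mapping.single r q)"
  shows "word a (n + t) (Poly_Mapping.single r (lvar j ^ t * q))"
proof (induction t)
  case 0
  then show ?case using assms by simp
next
  case (Suc t)
  then show ?case using word_lvar[OF Suc, of j] by (simp add: mult.assoc)
qed

lemma word_lvars:
  assumes "word a n (Poly_Mapping.single r q)" "finite A"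
  shows "word a (n + (\<Sum>j\<in>A. u j)) (Poly_Mapping.single r ((\<Prod>j\<in>A. lvar j ^ u j) * q))"
  using assms(2)
proof induction
  case empty
  then show ?case using assms by simp
next
  case (insert b A)
  then show ?case using word_lvar_power[OF insert.IH, of "u b" b] by (simp add: algebra_simps)
qed

lemma funpow_one: "(\<sigma> ^^ i) 1 = 1"
  by (induction i) (auto simp: one)

text \<open>The word is \<open>z\<^sup>u x\<^sup>i z\<^sub>j\<^sup>t x\<^bsup>r-i\<^esup>\<close>.\<close>

lemma word_monomial:
  assumes "i \<le> r"
  shows "\<exists>\<alpha>. \<alpha> \<noteq> 0 \<and> word a (r + t + (\<Sum>l\<in>UNIV. u l))
    (Poly_Mapping.single (int r) (Poly_Mapping.single (\<lambda>l. int (u l) + int t * (expo ^^ i) (unit_vec j) l) \<alpha>))"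
proof -
  obtain d where d: "d \<noteq> 0"
    "(\<sigma> ^^ i) (Poly_Mapping.single (\<lambda>l. int t * unit_vec j l) 1)
      = Poly_Mapping.single ((expo ^^ i) (\<lambda>l. int t * unit_vec j l)) d"
    using funpow_single[of 1 i "\<lambda>l. int t * unit_vec j l"] by auto
  \<comment> \<open>Words grow on the left, so the factors are attached in the order x^(r-i), z_j^t,
    x^i, z^u; the third step applies the \<open>i\<close>-th power of \<open>\<sigma>\<close> to
    z_j^t.\<close>
  have "word a (0 + (r - i)) (Poly_Mapping.single (int (0 + (r - i))) ((\<sigma> ^^ (r - i)) 1))"
    by (rule word_x_power) (use word_0 in simp)
  then have "word a (r - i) (Poly_Mapping.single (int (r - i)) 1)"
    by (simp add: funpow_one)
  then have "word a (r - i + t) (Poly_Mapping.single (int (r - i)) (lvar j ^ t * 1))"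
    by (rule word_lvar_power)
  then have "word a (r - i + t + i) (Poly_Mapping.single (int (r - i + i)) ((\<sigma> ^^ i) (lvar j ^ t * 1)))"
    by (rule word_x_power)
  then have "word a (r - i + t + i + (\<Sum>l\<in>UNIV. u l)) (Poly_Mapping.single (int (r - i + i))
      ((\<Prod>l\<in>UNIV. lvar l ^ u l) * (\<sigma> ^^ i) (lvar j ^ t * 1)))"
    by (rule word_lvars) simp
  moreover have "(\<Prod>l\<in>UNIV. lvar l ^ u l) * (\<sigma> ^^ i) (lvar j ^ t * 1)
      = Poly_Mapping.single (\<lambda>l. int (u l) + int t * (expo ^^ i) (unit_vec j) l) d"
    unfolding prod_lvar_power
    unfolding lvar_power mult_1_right d(2) expo_funpow_times mult_single
    by (simp add: plus_fun_def)
  moreover have "r - i + t + i = r + t" "r - i + i = r" using assms by auto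
  ultimately show ?thesis using d(1) by metis
qed

lemma word_in_growth_space:
  assumes "word a n F" "n \<le> N"
  shows "F \<in> (\<Union>i\<in>{0..N}. gwa_power_space \<sigma> a (gwa.span gens) i)"
proof -
  have "F \<in> gwa_power_space \<sigma> a (gwa.span gens) n"
    unfolding gwa_power_space_def
    by (rule gwa.span_base) (use assms(1) gwa.span_superset[of gens] in \<open>unfold word_def, blast\<close>)
  then show ?thesis using assms(2) by auto
qed

text \<open>The exponents \<open>u + t g\<close>, with \<open>u\<close> in a box of side \<open>K\<close> and \<open>t\<close> a multiple of \<open>s\<close>, are
  pairwise distinct because \<open>g\<close> has a coordinate of size at least \<open>q\<close> and \<open>s q > K\<close>.\<close>

lemma growth_lower_bound:
  assumes q: "1 \<le> q" "q \<le> K" and i: "i \<le> K" and big: "int q \<le> \<bar>(expo ^^ i) (unit_vec j) k\<bar>"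
  shows "K ^ (CARD('n) + 1) * q \<le> gwa_growth \<sigma> a (gwa.span gens) ((CARD('n) + 4) * K)"
proof -
  define g where "g = (expo ^^ i) (unit_vec j)"
  \<comment> \<open>The least \<open>s\<close> with \<open>s * q > K\<close>. Because
    \<open>q \<le> K\<close>, also \<open>s * q \<le> 2 * K\<close>, which keeps the power of z_j
    affordable.\<close>
  define s where "s = K div q + 1"
  \<comment> \<open>Degrees start at \<open>K\<close> so that \<open>i \<le> r\<close> always holds;
    the count is \<open>K\<close> degrees, K^n vectors \<open>u\<close> and \<open>q\<close> values
    of \<open>t\<close>.\<close>
  define I where "I = {K..<2 * K} \<times> (PiE (UNIV :: 'n set) (\<lambda>_. {..<K})) \<times> {..<q}"
  define v where "v = (\<lambda>(r :: nat, u :: 'n \<Rightarrow> nat, t) l. int (u l) + int (s * t) * g l)"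
  have sq: "K < s * q" "s * q \<le> 2 * K"
  proof -
    have "s * q = K div q * q + q" by (simp add: s_def)
    moreover have "K mod q < q" using q by simp
    ultimately show "K < s * q" "s * q \<le> 2 * K" using q(2) div_mult_mod_eq[of K q] by linarith+
  qed
  have inj: "inj_on (\<lambda>x. (int (fst x), v x)) I"
  proof (rule inj_onI)
    fix x y assume xy: "x \<in> I" "y \<in> I" "(int (fst x), v x) = (int (fst y), v y)"
    obtain r u t where x: "x = (r, u, t)" by (cases x)
    obtain r' u' t' where y: "y = (r', u', t')" by (cases y)
    have r: "r = r'" using xy by (simp add: x y)
    have veq: "int (u l) + int (s * t) * g l = int (u' l) + int (s * t') * g l" for l
      using xy(3) by (auto simp: x y v_def dest: fun_cong[of _ _ l])
    have "t = t'"
    proof (rule ccontr)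
      assume "t \<noteq> t'"
      then have "1 \<le> \<bar>int t' - int t\<bar>" by linarith
      then have "int s * 1 \<le> int s * \<bar>int t' - int t\<bar>" by (rule mult_left_mono) simp
      then have "int s * int q \<le> (int s * \<bar>int t' - int t\<bar>) * \<bar>g k\<bar>"
        using big q by (intro mult_mono) (auto simp: g_def)
      also have "\<dots> = \<bar>int s * (int t' - int t) * g k\<bar>" by (simp add: abs_mult)
      also have "int s * (int t' - int t) * g k = int (u k) - int (u' k)"
        using veq[of k] by (simp add: algebra_simps)
      also have "\<bar>int (u k) - int (u' k)\<bar> < int K"
      proof -
        have "u k < K" "u' k < K" using xy by (auto simp: I_def x y)
        then show ?thesis by linarith
      qed
      finally have "s * q < K" by (simp flip: of_nat_mult)
      then show False using sq(1) by simp
    qed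
    moreover have "u = u'" using veq \<open>t = t'\<close> by auto
    ultimately show "x = y" using r by (simp add: x y)
  qed
  have "\<forall>x\<in>I. \<exists>\<alpha>. \<alpha> \<noteq> 0 \<and> Poly_Mapping.single (int (fst x)) (Poly_Mapping.single (v x) \<alpha>)
      \<in> (\<Union>i\<in>{0..(CARD('n) + 4) * K}. gwa_power_space \<sigma> a (gwa.span gens) i)"
  proof
    fix x assume xI: "x \<in> I"
    obtain r u t where x: "x = (r, u, t)" by (cases x)
    have r: "K \<le> r" "r \<le> 2 * K" and u: "\<And>l. u l < K" and t: "t \<le> q" using xI by (auto simp: I_def x)
    have "(\<Sum>l\<in>UNIV. u l) \<le> CARD('n) * K"
      using sum_bounded_above[of UNIV u K] u by (simp add: less_imp_le)
    moreover have "s * t \<le> 2 * K" using sq(2) mult_le_mono2[OF t, of s] by linarith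
    \<comment> \<open>The length budget is 2K letters \<open>x\<close>, 2K letters z_j, and n K
      letters for z^u.\<close>
    ultimately have len: "r + s * t + (\<Sum>l\<in>UNIV. u l) \<le> (CARD('n) + 4) * K"
      using r(2) by (simp add: algebra_simps)
    have "i \<le> r" using i r by simp
    from word_monomial[OF this, of a "s * t" u j] obtain \<alpha> where "\<alpha> \<noteq> 0"
      "word a (r + s * t + (\<Sum>l\<in>UNIV. u l)) (Poly_Mapping.single (int r) (Poly_Mapping.single (v x) \<alpha>))"
      by (auto simp: v_def x g_def)
    then show "\<exists>\<alpha>. \<alpha> \<noteq> 0 \<and> Poly_Mapping.single (int (fst x)) (Poly_Mapping.single (v x) \<alpha>)
      \<in> (\<Union>i\<in>{0..(CARD('n) + 4) * K}. gwa_power_space \<sigma> a (gwa.span gens) i)"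
      using word_in_growth_space[OF _ len] by (auto simp only: x fst_conv)
  qed
  from bchoice[OF this] obtain \<alpha> where \<alpha>: "\<And>x. x \<in> I \<Longrightarrow> \<alpha> x \<noteq> 0"
    "\<And>x. x \<in> I \<Longrightarrow> Poly_Mapping.single (int (fst x)) (Poly_Mapping.single (v x) (\<alpha> x))
      \<in> (\<Union>i\<in>{0..(CARD('n) + 4) * K}. gwa_power_space \<sigma> a (gwa.span gens) i)"
    by blast
  let ?B = "(\<lambda>x. Poly_Mapping.single (int (fst x)) (Poly_Mapping.single (v x) (\<alpha> x))) ` I"
  have "card ?B \<le> gwa_growth \<sigma> a (gwa.span gens) ((CARD('n) + 4) * K)"
  proof (rule growth_ge_card)
    show "finite gens" by (simp add: gens_def)
    show "gwa.independent ?B" by (rule independent_monomials(2)[OF inj \<alpha>(1)])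
    show "?B \<subseteq> (\<Union>i\<in>{0..(CARD('n) + 4) * K}. gwa_power_space \<sigma> a (gwa.span gens) i)"
      using \<alpha>(2) by blast
  qed
  moreover have "card ?B = card I"
    by (rule card_image, rule independent_monomials(1)[OF inj \<alpha>(1)])
  moreover have "card I = K ^ (CARD('n) + 1) * q"
    by (simp add: I_def card_cartesian_product card_PiE)
  ultimately show ?thesis by simp
qed

section \<open>The Gelfand--Kirillov dimension\<close>

text \<open>A limsup dominates the limit along any subsequence, so it suffices to bound the growth
  from below at the sparse arguments \<open>\<phi> p\<close>.\<close>

lemma GKdim_gwa_ge:
  assumes "strict_mono \<phi>" "Y \<longlonglongrightarrow> L"
    and Y: "\<And>p. Y p \<le> ln (real (gwa_growth \<sigma> a (gwa.span gens) (\<phi> p))) / ln (real (\<phi> p))"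
  shows "ereal L \<le> GKdim_gwa \<sigma> a"
proof -
  let ?X = "\<lambda>N. ereal (ln (real (gwa_growth \<sigma> a (gwa.span gens) N)) / ln (real N))"
  have "(\<lambda>p. ereal (Y p)) \<longlonglongrightarrow> ereal L" using assms(2) by simp
  then have "ereal L = limsup (\<lambda>p. ereal (Y p))"
    by (rule lim_imp_Limsup[OF trivial_limit_sequentially, symmetric])
  also have "\<dots> \<le> limsup (?X \<circ> \<phi>)"
    by (rule Limsup_mono) (use Y in simp)
  also have "\<dots> \<le> limsup ?X" by (rule limsup_subseq_mono[OF assms(1)])
  also have "\<dots> \<le> GKdim_gwa \<sigma> a"
    unfolding GKdim_gwa_def
    by (rule SUP_upper) (auto simp: gens_def intro!: exI[of _ gens])
  finally show ?thesis .
qed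

lemma ln_growth_lower_bound:
  assumes "1 \<le> q" "q \<le> K" "i \<le> K" "int q \<le> \<bar>(expo ^^ i) (unit_vec j) k\<bar>"
  shows "(real (CARD('n) + 1) * ln (real K) + ln (real q)) / (ln (real (CARD('n) + 4)) + ln (real K))
    \<le> ln (real (gwa_growth \<sigma> a (gwa.span gens) ((CARD('n) + 4) * K))) / ln (real ((CARD('n) + 4) * K))"
proof -
  have K: "real K \<ge> 1" using assms by linarith
  have "real (K ^ (CARD('n) + 1) * q) \<le> real (gwa_growth \<sigma> a (gwa.span gens) ((CARD('n) + 4) * K))"
    using growth_lower_bound[OF assms] of_nat_mono by blast
  moreover have "real (K ^ (CARD('n) + 1) * q) > 0" using assms by simp
  ultimately have "ln (real (K ^ (CARD('n) + 1) * q))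
      \<le> ln (real (gwa_growth \<sigma> a (gwa.span gens) ((CARD('n) + 4) * K)))"
    by (subst ln_le_cancel_iff) linarith+
  moreover have "ln (real (K ^ (CARD('n) + 1) * q)) = real (CARD('n) + 1) * ln (real K) + ln (real q)"
    using K assms by (simp add: ln_mult ln_realpow algebra_simps)
  moreover have "ln (real ((CARD('n) + 4) * K)) = ln (real (CARD('n) + 4)) + ln (real K)"
    using K by (simp only: of_nat_mult) (subst ln_mult, auto)
  moreover have "ln (real (CARD('n) + 4)) + ln (real K) \<ge> 0"
    using K by (intro add_nonneg_nonneg) auto
  ultimately show ?thesis by (metis divide_right_mono)
qed

text \<open>Valid for every automorphism: with \<open>i = 0\<close> and \<open>q = 1\<close> the
  required large entry is the entry 1 of a unit vector, at any index.\<close>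

lemma GKdim_gwa_ge_Suc: "ereal (real CARD('n) + 1) \<le> GKdim_gwa \<sigma> a"
proof (rule GKdim_gwa_ge)
  show "strict_mono (\<lambda>p. (CARD('n) + 4) * Suc p)"
    by (rule strict_monoI) simp
  show "(\<lambda>p. (real (CARD('n) + 1) * ln (real (Suc p)) + ln (real 1)) / (ln (real (CARD('n) + 4)) + ln (real (Suc p))))
      \<longlonglongrightarrow> real CARD('n) + 1"
    by real_asymp
  show "(real (CARD('n) + 1) * ln (real (Suc p)) + ln (real 1)) / (ln (real (CARD('n) + 4)) + ln (real (Suc p)))
      \<le> ln (real (gwa_growth \<sigma> a (gwa.span gens) ((CARD('n) + 4) * Suc p))) / ln (real ((CARD('n) + 4) * Suc p))" for p
    by (rule ln_growth_lower_bound[of _ _ 0 undefined undefined]) (auto simp: unit_vec_def)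
qed

text \<open>Take \<open>q = Suc p\<close>, so that \<open>K\<close> is about (2q)^d with
  \<open>d\<close> = n^2. Then ln q / ln K tends to 1/d, and the extra factor \<open>q\<close> in
  the count lifts the exponent strictly above n + 1.\<close>

lemma GKdim_gwa_gt:
  assumes inf: "\<And>m. m \<ge> 1 \<Longrightarrow> expo ^^ m \<noteq> id"
  shows "ereal (real CARD('n) + 1) < GKdim_gwa \<sigma> a"
proof -
  define c d where "c = real CARD('n)" and "d = CARD('n) * CARD('n)"
  have d: "d > 0" by (simp add: d_def)
  define K where "K = (\<lambda>p. (2 * Suc p + 1) ^ d)"
  have lnK: "ln (real (K p)) = real d * ln (2 * real p + 3)" for p
    by (simp add: K_def ln_realpow algebra_simps)
  have "ereal (c + 1 + 1 / real d) \<le> GKdim_gwa \<sigma> a"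
  proof (rule GKdim_gwa_ge)
    show "strict_mono (\<lambda>p. (CARD('n) + 4) * K p)"
    proof (rule strict_monoI)
      fix p p' :: nat assume "p < p'"
      then have "K p < K p'" unfolding K_def using d by (intro power_strict_mono) auto
      then show "(CARD('n) + 4) * K p < (CARD('n) + 4) * K p'" by simp
    qed
    show "(\<lambda>p. (real (CARD('n) + 1) * ln (real (K p)) + ln (real (Suc p))) / (ln (real (CARD('n) + 4)) + ln (real (K p))))
        \<longlonglongrightarrow> c + 1 + 1 / real d"
    proof -
      \<comment> \<open>Since ln K equals \<open>d * h\<close>, dividing numerator and denominator
        by \<open>h\<close> leaves two elementary limits.\<close>
      define h where "h = (\<lambda>p. ln (2 * real p + 3))"
      have h: "h p > 0" for p by (simp add: h_def)
      have "(\<lambda>p. ln (real (Suc p)) / h p) \<longlonglongrightarrow> 1" unfolding h_def by real_asymp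
      moreover have "(\<lambda>p. ln (c + 4) / h p) \<longlonglongrightarrow> 0" unfolding h_def by real_asymp
      ultimately have "(\<lambda>p. ((c + 1) * real d + ln (real (Suc p)) / h p) / (ln (c + 4) / h p + real d))
          \<longlonglongrightarrow> ((c + 1) * real d + 1) / (0 + real d)"
        using d by (intro tendsto_intros) auto
      moreover have "((c + 1) * real d + ln (real (Suc p)) / h p) / (ln (c + 4) / h p + real d)
          = (real (CARD('n) + 1) * ln (real (K p)) + ln (real (Suc p))) / (ln (real (CARD('n) + 4)) + ln (real (K p)))" for p
      proof -
        have "((c + 1) * real d + ln (real (Suc p)) / h p) / (ln (c + 4) / h p + real d)
          = (((c + 1) * real d + ln (real (Suc p)) / h p) * h p) / ((ln (c + 4) / h p + real d) * h p)"
          using h[of p] by simp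
        also have "\<dots> = ((c + 1) * (real d * h p) + ln (real (Suc p))) / (ln (c + 4) + real d * h p)"
          using h[of p] by (simp add: distrib_right)
        finally show ?thesis by (simp add: lnK h_def c_def add.commute)
      qed
      moreover have "((c + 1) * real d + 1) / (0 + real d) = c + 1 + 1 / real d"
        using d by (simp add: add_divide_distrib)
      ultimately show ?thesis by simp
    qed
    fix p
    obtain i j k where ijk: "i \<le> K p" "int (Suc p) < \<bar>(expo ^^ i) (unit_vec j) k\<bar>"
      using infinite_order_large_entry[OF inf, of "Suc p"] unfolding K_def d_def by blast
    have "Suc p \<le> 2 * Suc p + 1" by simp
    also have "\<dots> \<le> K p" unfolding K_def using d by (intro self_le_power) auto
    finally have "Suc p \<le> K p" .
    then show "(real (CARD('n) + 1) * ln (real (K p)) + ln (real (Suc p))) / (ln (real (CARD('n) + 4)) + ln (real (K p)))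
        \<le> ln (real (gwa_growth \<sigma> a (gwa.span gens) ((CARD('n) + 4) * K p))) / ln (real ((CARD('n) + 4) * K p))"
      using ijk by (intro ln_growth_lower_bound[of _ _ i j k]) auto
  qed
  moreover have "real CARD('n) + 1 < c + 1 + 1 / real d" using d by (simp add: c_def)
  ultimately show ?thesis
    by (meson less_ereal.simps(1) less_le_trans)
qed

lemma GKdim_gwa_le:
  assumes m: "m \<ge> 1" "expo ^^ m = id"
  shows "GKdim_gwa \<sigma> a \<le> ereal (real CARD('n) + 1)"
  unfolding GKdim_gwa_def
proof (rule SUP_least, elim CollectE exE conjE)
  fix V and S :: "('n, 'k) laurent gwa set" assume S: "finite S" and V: "V = gwa.span S"
  obtain C where C: "C \<ge> 1"
    "\<And>N. N \<ge> 1 \<Longrightarrow> real (gwa_growth \<sigma> a (gwa.span S) N) \<le> C * real N ^ (CARD('n) + 1)"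
    using growth_polynomial_bound[OF m S] by blast
  let ?Y = "\<lambda>N. (ln C + (real CARD('n) + 1) * ln (real N)) / ln (real N)"
  have "limsup (\<lambda>N. ereal (ln (real (gwa_growth \<sigma> a V N)) / ln (real N))) \<le> limsup (\<lambda>N. ereal (?Y N))"
  proof (rule Limsup_mono, rule eventually_mono[OF eventually_ge_at_top[of 1]])
    fix N :: nat assume N: "N \<ge> 1"
    have ge1: "1 * 1 \<le> C * real N ^ (CARD('n) + 1)"
      using C(1) N by (intro mult_mono one_le_power) auto
    have "ln (real (gwa_growth \<sigma> a V N)) \<le> ln (C * real N ^ (CARD('n) + 1))"
    proof (cases "gwa_growth \<sigma> a V N = 0")
      \<comment> \<open>Covered by the convention \<open>ln 0 = 0\<close>, as the right side is at
        least \<open>ln 1\<close>.\<close>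
      case True
      then show ?thesis using ge1 by simp
    next
      case False
      then show ?thesis using C(2)[OF N] by (simp add: V)
    qed
    also have "\<dots> = ln C + (real CARD('n) + 1) * ln (real N)"
    proof -
      have "ln (real N ^ (CARD('n) + 1)) = real (CARD('n) + 1) * ln (real N)"
        by (rule ln_realpow)
      moreover have "ln (C * real N ^ (CARD('n) + 1)) = ln C + ln (real N ^ (CARD('n) + 1))"
        using C(1) N by (subst ln_mult) auto
      ultimately show ?thesis by (simp only: of_nat_add of_nat_1)
    qed
    finally show "ereal (ln (real (gwa_growth \<sigma> a V N)) / ln (real N)) \<le> ereal (?Y N)"
      using N by (simp add: divide_right_mono)
  qed
  also have "?Y \<longlonglongrightarrow> real CARD('n) + 1" by real_asymp
  then have "limsup (\<lambda>N. ereal (?Y N)) = ereal (real CARD('n) + 1)"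
    by (intro lim_imp_Limsup) auto
  finally show "limsup (\<lambda>N. ereal (ln (real (gwa_growth \<sigma> a V N)) / ln (real N))) \<le> ereal (real CARD('n) + 1)" .
qed

lemma GKdim_gwa_eq_iff_finite_order:
  "GKdim_gwa \<sigma> a = ereal (real CARD('n) + 1) \<longleftrightarrow> (\<exists>m\<ge>1. expo ^^ m = id)"
proof
  assume "GKdim_gwa \<sigma> a = ereal (real CARD('n) + 1)"
  then show "\<exists>m\<ge>1. expo ^^ m = id" using GKdim_gwa_gt[of a] by fastforce
next
  assume "\<exists>m\<ge>1. expo ^^ m = id"
  then show "GKdim_gwa \<sigma> a = ereal (real CARD('n) + 1)"
    using GKdim_gwa_le GKdim_gwa_ge_Suc antisym by blast
qed

end

theorem theorem0p3:
  fixes \<sigma> :: "('n::finite, 'k::field) laurent \<Rightarrow> ('n, 'k) laurent"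
    and a :: "('n, 'k) laurent"
  assumes "k_alg_automorphism \<sigma>"
  shows "(GKdim_gwa \<sigma> a = ereal (real CARD('n) + 1) \<longleftrightarrow> locally_algebraic \<sigma>)
       \<and> (locally_algebraic \<sigma> \<longleftrightarrow> (\<exists>m\<ge>1. mat_pow (sigma_matrix \<sigma>) m = mat 1))
       \<and> ((\<exists>m\<ge>1. mat_pow (sigma_matrix \<sigma>) m = mat 1) \<longleftrightarrow>
          (\<exists>N>0. \<forall>m\<ge>1. \<forall>i j. \<bar>mat_pow (sigma_matrix \<sigma>) m $ i $ j\<bar> < N))"
proof -
  interpret laurent_aut \<sigma> by unfold_locales (rule assms)
  show ?thesis
    \<comment> \<open>All four conditions become the single statement that some positive iterate of
      \<open>expo\<close> is the identity.\<close>
    unfolding mat_pow_eq_1_iff mat_pow_entry GKdim_gwa_eq_iff_finite_order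
      locally_algebraic_iff_finite_order finite_order_iff_bounded[symmetric]
    by simp
qed

end
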